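(* Let $\bar M$ be a Kähler manifold. Then there exist no (non-trivial) biwarped product submanifolds of the form $M_\theta\times_f M_T\times_\sigma M_\bot$ of $\bar M$ such that $M_\theta$ is a proper pointwise slant or proper slant, $M_T$ is a holomorphic and $M_\bot$ is a totally real submanifold of $\bar M$.
   Context: A Kähler manifold $(\bar M,J,g)$ is an almost complex manifold with Riemannian metric $g$ with $g(JX,JY)=g(X,Y)$ and $\bar\nabla J=0$, where $\bar\nabla$ is the Levi-Civita connection. A submanifold $N$ of $\bar M$ is pointwise slant if at each $p\in N$ the angle $\theta$ between $JV$ and $T_pN$ is independent of the nonzero vector $V\in T_pN$; the function $\theta$ on $N$ is the slant function. It is slant if $\theta$ is constant, and a pointwise slant (or slant) submanifold is proper if neither $\cos\theta(p)=0$ nor $\sin\theta(p)=0$ at each point $p$. $N$ is holomorphic if $J(T_pN)\subseteq T_pN$ for all $p$, and totally real if $J(T_pN)\subseteq T_p^\bot N$ for all $p$. For Riemannian manifolds $(M_i,g_i)$, $i=0,1,2$, and smooth $f_1,f_2:M_0\to(0,\infty)$, the biwarped product $M_0\times_{f_1}M_1\times_{f_2}M_2$ is $M_0\times M_1\times M_2$ with metric $\pi_0^*g_0+(f_1\circ\pi_0)^2\pi_1^*g_1+(f_2\circ\pi_0)^2\pi_2^*g_2$, $\pi_i$ being the projections. It is called trivial if the warping functions $f_1$ and $f_2$ are constants. A biwarped product submanifold of $\bar M$ is an isometrically immersed submanifold of $\bar M$ that is a biwarped product with its induced metric.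
   Formalization: "Non-trivial" is taken to mean that f, the warping function of the holomorphic factor, is non-constant (σ is arbitrary), and M_θ is assumed connected; with f constant and σ non-constant such submanifolds exist, e.g. (ζ cos t, ζ sin t, k ζ̄, z) in C^4. *)

theory Defs
  imports "HOL-Analysis.Analysis"
begin

section \<open>Smooth manifolds\<close>

text \<open>
  Only used on open sets \<open>S\<close>, where \<open>at x\<close> and \<open>at x within S\<close> agree.  In finite dimension,
  differentiating in each fixed direction \<open>v\<close> gives the usual classes of \<open>k\<close> times
  continuously differentiable maps.
\<close>

primrec Ck_on :: "nat \<Rightarrow> 'a::euclidean_space set \<Rightarrow> ('a \<Rightarrow> 'b::real_normed_vector) \<Rightarrow> bool" where
  "Ck_on 0 S f \<longleftrightarrow> continuous_on S f"
| "Ck_on (Suc k) S f \<longleftrightarrow> (\<forall>x\<in>S. f differentiable (at x)) \<and>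
     (\<forall>v. Ck_on k S (\<lambda>x. frechet_derivative f (at x) v))"

definition smooth_on :: "'a::euclidean_space set \<Rightarrow> ('a \<Rightarrow> 'b::real_normed_vector) \<Rightarrow> bool" where
  "smooth_on S f \<longleftrightarrow> (\<forall>k. Ck_on k S f)"

text \<open>
  The underlying space of a manifold is a whole type.  A chart is a pair of its domain and the
  coordinate map (irrelevant outside the domain); the dimension of the manifold is the dimension of
  the model space, in particular it is positive.
\<close>

type_synonym ('m, 'e) chart = "'m set \<times> ('m \<Rightarrow> 'e)"

definition chart_inv :: "('m, 'e) chart \<Rightarrow> 'e \<Rightarrow> 'm" where
  "chart_inv c = inv_into (fst c) (snd c)"

definition is_chart :: "('m::topological_space, 'e::euclidean_space) chart \<Rightarrow> bool" where
  "is_chart c \<longleftrightarrow> open (fst c) \<and> open (snd c ` fst c) \<and>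
     homeomorphism (fst c) (snd c ` fst c) (snd c) (chart_inv c)"

definition smooth_atlas ::
    "('m::{t2_space,second_countable_topology}, 'e::euclidean_space) chart set \<Rightarrow> bool" where
  "smooth_atlas A \<longleftrightarrow> (\<forall>c\<in>A. is_chart c) \<and> (\<Union>c\<in>A. fst c) = UNIV \<and>
     (\<forall>c\<in>A. \<forall>d\<in>A. smooth_on (snd c ` (fst c \<inter> fst d)) (snd d \<circ> chart_inv c))"

definition prod_atlas :: "('a, 'e) chart set \<Rightarrow> ('b, 'f) chart set \<Rightarrow> ('a \<times> 'b, 'e \<times> 'f) chart set" where
  "prod_atlas A B = (\<lambda>(c, d). (fst c \<times> fst d, map_prod (snd c) (snd d))) ` (A \<times> B)"

definition smooth_fun ::
    "('m::topological_space, 'e::euclidean_space) chart set \<Rightarrow> 'm set \<Rightarrow> ('m \<Rightarrow> real) \<Rightarrow> bool" where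
  "smooth_fun A U h \<longleftrightarrow> (\<forall>c\<in>A. smooth_on (snd c ` (fst c \<inter> U)) (h \<circ> chart_inv c))"

definition smooth_near ::
    "('m::topological_space, 'e::euclidean_space) chart set \<Rightarrow> 'm \<Rightarrow> ('m \<Rightarrow> real) \<Rightarrow> bool" where
  "smooth_near A p h \<longleftrightarrow> (\<exists>U. open U \<and> p \<in> U \<and> smooth_fun A U h)"

definition smooth_map ::
    "('m::topological_space, 'e::euclidean_space) chart set \<Rightarrow>
     ('n::topological_space, 'f::euclidean_space) chart set \<Rightarrow> ('m \<Rightarrow> 'n) \<Rightarrow> bool" where
  "smooth_map A B F \<longleftrightarrow> continuous_on UNIV F \<and>
     (\<forall>c\<in>A. \<forall>d\<in>B. smooth_on (snd c ` (fst c \<inter> F -` fst d)) (snd d \<circ> F \<circ> chart_inv c))"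

section \<open>Tangent vectors and vector fields\<close>

text \<open>
  A tangent vector at \<open>p\<close> is a directional derivative operator
  \<open>\<Sum>i. a\<^sub>i \<partial>/\<partial>x\<^sub>i\<close> in some chart around \<open>p\<close>, acting on functions that are smooth near \<open>p\<close>.  It is
  set to \<open>0\<close> on all other functions, so that equality of tangent vectors is plain equality.
\<close>

type_synonym 'm tvec = "('m \<Rightarrow> real) \<Rightarrow> real"

definition coord_vec ::
    "('m::topological_space, 'e::euclidean_space) chart set \<Rightarrow> ('m, 'e) chart \<Rightarrow> 'm \<Rightarrow> 'e \<Rightarrow> 'm tvec" where
  "coord_vec A c p a =
     (\<lambda>h. if smooth_near A p h then frechet_derivative (h \<circ> chart_inv c) (at (snd c p)) a else 0)"

definition tangent_space ::
    "('m::topological_space, 'e::euclidean_space) chart set \<Rightarrow> 'm \<Rightarrow> 'm tvec set" where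
  "tangent_space A p = {coord_vec A c p a | c a. c \<in> A \<and> p \<in> fst c}"

definition lincomb :: "real \<Rightarrow> 'm tvec \<Rightarrow> real \<Rightarrow> 'm tvec \<Rightarrow> 'm tvec" where
  "lincomb a u b v = (\<lambda>h. a * u h + b * v h)"

definition zero_vec :: "'m tvec" where
  "zero_vec = (\<lambda>h. 0)"

text \<open>The differential \<open>dF\<^sub>p\<close>; \<open>B\<close> is the atlas of the target manifold.\<close>

definition push ::
    "('n::topological_space, 'f::euclidean_space) chart set \<Rightarrow> ('m \<Rightarrow> 'n) \<Rightarrow> 'm \<Rightarrow> 'm tvec \<Rightarrow> 'n tvec" where
  "push B F p v = (\<lambda>h. if smooth_near B (F p) h then v (h \<circ> F) else 0)"

definition immersion ::
    "('m::topological_space, 'e::euclidean_space) chart set \<Rightarrow>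
     ('n::topological_space, 'f::euclidean_space) chart set \<Rightarrow> ('m \<Rightarrow> 'n) \<Rightarrow> bool" where
  "immersion A B F \<longleftrightarrow> smooth_map A B F \<and> (\<forall>p. inj_on (push B F p) (tangent_space A p))"

text \<open>Smooth vector fields on an open set \<open>U\<close>; values outside \<open>U\<close> are irrelevant.\<close>

definition vector_field ::
    "('m::topological_space, 'e::euclidean_space) chart set \<Rightarrow> 'm set \<Rightarrow> ('m \<Rightarrow> 'm tvec) \<Rightarrow> bool" where
  "vector_field A U X \<longleftrightarrow> (\<forall>q\<in>U. X q \<in> tangent_space A q) \<and>
     (\<forall>V h. open V \<longrightarrow> V \<subseteq> U \<longrightarrow> smooth_fun A V h \<longrightarrow> smooth_fun A V (\<lambda>q. X q h))"

definition lie_bracket ::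
    "('m::topological_space, 'e::euclidean_space) chart set \<Rightarrow>
     ('m \<Rightarrow> 'm tvec) \<Rightarrow> ('m \<Rightarrow> 'm tvec) \<Rightarrow> 'm \<Rightarrow> 'm tvec" where
  "lie_bracket A X Y p =
     (\<lambda>h. if smooth_near A p h then X p (\<lambda>q. Y q h) - Y p (\<lambda>q. X q h) else 0)"

section \<open>Riemannian and Kaehler manifolds\<close>

type_synonym 'm metric_field = "'m \<Rightarrow> 'm tvec \<Rightarrow> 'm tvec \<Rightarrow> real"

definition riemannian_metric ::
    "('m::topological_space, 'e::euclidean_space) chart set \<Rightarrow> 'm metric_field \<Rightarrow> bool" where
  "riemannian_metric A g \<longleftrightarrow>
     (\<forall>p. \<forall>u\<in>tangent_space A p. \<forall>v\<in>tangent_space A p. g p u v = g p v u) \<and>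
     (\<forall>p. \<forall>u\<in>tangent_space A p. \<forall>v\<in>tangent_space A p. \<forall>w\<in>tangent_space A p. \<forall>a b.
        g p (lincomb a u b v) w = a * g p u w + b * g p v w) \<and>
     (\<forall>p. \<forall>u\<in>tangent_space A p. u \<noteq> zero_vec \<longrightarrow> 0 < g p u u) \<and>
     (\<forall>U X Y. open U \<longrightarrow> vector_field A U X \<longrightarrow> vector_field A U Y \<longrightarrow>
        smooth_fun A U (\<lambda>q. g q (X q) (Y q)))"

definition riemannian_manifold ::
    "('m::{t2_space,second_countable_topology}, 'e::euclidean_space) chart set \<Rightarrow> 'm metric_field \<Rightarrow> bool" where
  "riemannian_manifold A g \<longleftrightarrow> smooth_atlas A \<and> riemannian_metric A g"

definition almost_complex_structure ::
    "('m::topological_space, 'e::euclidean_space) chart set \<Rightarrow> ('m \<Rightarrow> 'm tvec \<Rightarrow> 'm tvec) \<Rightarrow> bool" where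
  "almost_complex_structure A J \<longleftrightarrow>
     (\<forall>p. \<forall>u\<in>tangent_space A p. J p u \<in> tangent_space A p) \<and>
     (\<forall>p. \<forall>u\<in>tangent_space A p. \<forall>v\<in>tangent_space A p. \<forall>a b.
        J p (lincomb a u b v) = lincomb a (J p u) b (J p v)) \<and>
     (\<forall>p. \<forall>u\<in>tangent_space A p. J p (J p u) = lincomb (-1) u 0 zero_vec) \<and>
     (\<forall>U X. open U \<longrightarrow> vector_field A U X \<longrightarrow> vector_field A U (\<lambda>q. J q (X q)))"

text \<open>
  \<open>nabla p u Y\<close> is the covariant derivative at \<open>p\<close> of the vector field \<open>Y\<close> in the direction
  \<open>u \<in> T\<^sub>pM\<close>.  The fields are fields on arbitrary open sets.  Since functions are total and only their
  behaviour near \<open>p\<close> is constrained, the Leibniz rule forces \<open>nabla p u Y\<close> to depend only on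
  the germ of \<open>Y\<close> at \<open>p\<close>.
\<close>

definition affine_connection ::
    "('m::topological_space, 'e::euclidean_space) chart set \<Rightarrow>
     ('m \<Rightarrow> 'm tvec \<Rightarrow> ('m \<Rightarrow> 'm tvec) \<Rightarrow> 'm tvec) \<Rightarrow> bool" where
  "affine_connection A nabla \<longleftrightarrow>
     (\<forall>U Y. open U \<longrightarrow> vector_field A U Y \<longrightarrow>
        (\<forall>p\<in>U. \<forall>u\<in>tangent_space A p. nabla p u Y \<in> tangent_space A p) \<and>
        (\<forall>p\<in>U. \<forall>u\<in>tangent_space A p. \<forall>v\<in>tangent_space A p. \<forall>a b.
           nabla p (lincomb a u b v) Y = lincomb a (nabla p u Y) b (nabla p v Y)) \<and>
        (\<forall>Z. vector_field A U Z \<longrightarrow> (\<forall>p\<in>U. \<forall>u\<in>tangent_space A p.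
           nabla p u (\<lambda>q. lincomb 1 (Y q) 1 (Z q)) = lincomb 1 (nabla p u Y) 1 (nabla p u Z))) \<and>
        (\<forall>h. smooth_fun A U h \<longrightarrow> (\<forall>p\<in>U. \<forall>u\<in>tangent_space A p.
           nabla p u (\<lambda>q. lincomb (h q) (Y q) 0 zero_vec) = lincomb (u h) (Y p) (h p) (nabla p u Y))) \<and>
        (\<forall>X. vector_field A U X \<longrightarrow> vector_field A U (\<lambda>q. nabla q (X q) Y)))"

definition levi_civita ::
    "('m::topological_space, 'e::euclidean_space) chart set \<Rightarrow> 'm metric_field \<Rightarrow>
     ('m \<Rightarrow> 'm tvec \<Rightarrow> ('m \<Rightarrow> 'm tvec) \<Rightarrow> 'm tvec) \<Rightarrow> bool" where
  "levi_civita A g nabla \<longleftrightarrow> affine_connection A nabla \<and>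
     (\<forall>U X Y. open U \<longrightarrow> vector_field A U X \<longrightarrow> vector_field A U Y \<longrightarrow> (\<forall>p\<in>U.
        lincomb 1 (nabla p (X p) Y) (-1) (nabla p (Y p) X) = lie_bracket A X Y p)) \<and>
     (\<forall>U Y Z. open U \<longrightarrow> vector_field A U Y \<longrightarrow> vector_field A U Z \<longrightarrow>
        (\<forall>p\<in>U. \<forall>u\<in>tangent_space A p.
           u (\<lambda>q. g q (Y q) (Z q)) = g p (nabla p u Y) (Z p) + g p (Y p) (nabla p u Z)))"

text \<open>The last conjunct says \<open>(\<nabla>\<^sub>u J) Y = \<nabla>\<^sub>u (J Y) - J (\<nabla>\<^sub>u Y) = 0\<close> for the Levi-Civita connection.\<close>

definition kaehler_manifold ::
    "('m::{t2_space,second_countable_topology}, 'e::euclidean_space) chart set \<Rightarrow>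
     ('m \<Rightarrow> 'm tvec \<Rightarrow> 'm tvec) \<Rightarrow> 'm metric_field \<Rightarrow> bool" where
  "kaehler_manifold A J g \<longleftrightarrow> riemannian_manifold A g \<and> almost_complex_structure A J \<and>
     (\<forall>p. \<forall>u\<in>tangent_space A p. \<forall>v\<in>tangent_space A p. g p (J p u) (J p v) = g p u v) \<and>
     (\<exists>nabla. levi_civita A g nabla \<and>
        (\<forall>U Y. open U \<longrightarrow> vector_field A U Y \<longrightarrow> (\<forall>p\<in>U. \<forall>u\<in>tangent_space A p.
           nabla p u (\<lambda>q. J q (Y q)) = J p (nabla p u Y))))"

section \<open>Slant, holomorphic and totally real submanifolds\<close>

definition vec_angle :: "('v \<Rightarrow> 'v \<Rightarrow> real) \<Rightarrow> 'v \<Rightarrow> 'v \<Rightarrow> real" where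
  "vec_angle ip v w = arccos (ip v w / (sqrt (ip v v) * sqrt (ip w w)))"

text \<open>
  The angle between a nonzero vector and a nonzero linear subspace is the least angle with a nonzero
  vector of the subspace; it lies between \<open>0\<close> and \<open>\<pi>/2\<close>.
\<close>

definition subspace_angle :: "('m tvec \<Rightarrow> 'm tvec \<Rightarrow> real) \<Rightarrow> 'm tvec \<Rightarrow> 'm tvec set \<Rightarrow> real" where
  "subspace_angle ip v S = (INF w\<in>S - {zero_vec}. vec_angle ip v w)"

text \<open>
  Below a submanifold is given by an immersion \<open>i\<close> of a manifold with atlas \<open>N\<close> into
  the manifold with atlas \<open>A\<close>.
\<close>

definition submanifold_tangent ::
    "('n::topological_space, 'f::euclidean_space) chart set \<Rightarrow>
     ('m::topological_space, 'e::euclidean_space) chart set \<Rightarrow> ('n \<Rightarrow> 'm) \<Rightarrow> 'n \<Rightarrow> 'm tvec set" where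
  "submanifold_tangent N A i p = push A i p ` tangent_space N p"

definition slant_function ::
    "('n::topological_space, 'f::euclidean_space) chart set \<Rightarrow>
     ('m::topological_space, 'e::euclidean_space) chart set \<Rightarrow>
     ('m \<Rightarrow> 'm tvec \<Rightarrow> 'm tvec) \<Rightarrow> 'm metric_field \<Rightarrow> ('n \<Rightarrow> 'm) \<Rightarrow> ('n \<Rightarrow> real) \<Rightarrow> bool" where
  "slant_function N A J g i \<theta> \<longleftrightarrow>
     (\<forall>p. \<forall>V\<in>submanifold_tangent N A i p. V \<noteq> zero_vec \<longrightarrow>
        subspace_angle (g (i p)) (J (i p) V) (submanifold_tangent N A i p) = \<theta> p)"

definition proper_pointwise_slant ::
    "('n::topological_space, 'f::euclidean_space) chart set \<Rightarrow>
     ('m::topological_space, 'e::euclidean_space) chart set \<Rightarrow>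
     ('m \<Rightarrow> 'm tvec \<Rightarrow> 'm tvec) \<Rightarrow> 'm metric_field \<Rightarrow> ('n \<Rightarrow> 'm) \<Rightarrow> bool" where
  "proper_pointwise_slant N A J g i \<longleftrightarrow> immersion N A i \<and>
     (\<exists>\<theta>. slant_function N A J g i \<theta> \<and> (\<forall>p. cos (\<theta> p) \<noteq> 0 \<and> sin (\<theta> p) \<noteq> 0))"

definition proper_slant ::
    "('n::topological_space, 'f::euclidean_space) chart set \<Rightarrow>
     ('m::topological_space, 'e::euclidean_space) chart set \<Rightarrow>
     ('m \<Rightarrow> 'm tvec \<Rightarrow> 'm tvec) \<Rightarrow> 'm metric_field \<Rightarrow> ('n \<Rightarrow> 'm) \<Rightarrow> bool" where
  "proper_slant N A J g i \<longleftrightarrow> immersion N A i \<and>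
     (\<exists>\<theta>. slant_function N A J g i \<theta> \<and> \<theta> constant_on UNIV \<and>
        (\<forall>p. cos (\<theta> p) \<noteq> 0 \<and> sin (\<theta> p) \<noteq> 0))"

definition holomorphic_submanifold ::
    "('n::topological_space, 'f::euclidean_space) chart set \<Rightarrow>
     ('m::topological_space, 'e::euclidean_space) chart set \<Rightarrow>
     ('m \<Rightarrow> 'm tvec \<Rightarrow> 'm tvec) \<Rightarrow> ('n \<Rightarrow> 'm) \<Rightarrow> bool" where
  "holomorphic_submanifold N A J i \<longleftrightarrow> immersion N A i \<and>
     (\<forall>p. J (i p) ` submanifold_tangent N A i p \<subseteq> submanifold_tangent N A i p)"

definition totally_real_submanifold ::
    "('n::topological_space, 'f::euclidean_space) chart set \<Rightarrow>
     ('m::topological_space, 'e::euclidean_space) chart set \<Rightarrow>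
     ('m \<Rightarrow> 'm tvec \<Rightarrow> 'm tvec) \<Rightarrow> 'm metric_field \<Rightarrow> ('n \<Rightarrow> 'm) \<Rightarrow> bool" where
  "totally_real_submanifold N A J g i \<longleftrightarrow> immersion N A i \<and>
     (\<forall>p. \<forall>V\<in>submanifold_tangent N A i p. \<forall>W\<in>submanifold_tangent N A i p.
        g (i p) (J (i p) V) W = 0)"

section \<open>Biwarped products\<close>

definition biwarped_metric ::
    "('a::topological_space, 'ea::euclidean_space) chart set \<Rightarrow> 'a metric_field \<Rightarrow>
     ('b::topological_space, 'eb::euclidean_space) chart set \<Rightarrow> 'b metric_field \<Rightarrow>
     ('c::topological_space, 'ec::euclidean_space) chart set \<Rightarrow> 'c metric_field \<Rightarrow>
     ('a \<Rightarrow> real) \<Rightarrow> ('a \<Rightarrow> real) \<Rightarrow> ('a \<times> 'b \<times> 'c) metric_field" where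
  "biwarped_metric A0 g0 A1 g1 A2 g2 f1 f2 p u v =
     (let \<pi>0 = fst; \<pi>1 = fst \<circ> snd; \<pi>2 = snd \<circ> snd in
      g0 (\<pi>0 p) (push A0 \<pi>0 p u) (push A0 \<pi>0 p v)
      + (f1 (\<pi>0 p))\<^sup>2 * g1 (\<pi>1 p) (push A1 \<pi>1 p u) (push A1 \<pi>1 p v)
      + (f2 (\<pi>0 p))\<^sup>2 * g2 (\<pi>2 p) (push A2 \<pi>2 p u) (push A2 \<pi>2 p v))"

definition biwarped_data ::
    "('a::{t2_space,second_countable_topology}, 'ea::euclidean_space) chart set \<Rightarrow> 'a metric_field \<Rightarrow>
     ('b::{t2_space,second_countable_topology}, 'eb::euclidean_space) chart set \<Rightarrow> 'b metric_field \<Rightarrow>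
     ('c::{t2_space,second_countable_topology}, 'ec::euclidean_space) chart set \<Rightarrow> 'c metric_field \<Rightarrow>
     ('a \<Rightarrow> real) \<Rightarrow> ('a \<Rightarrow> real) \<Rightarrow> bool" where
  "biwarped_data A0 g0 A1 g1 A2 g2 f1 f2 \<longleftrightarrow>
     riemannian_manifold A0 g0 \<and> riemannian_manifold A1 g1 \<and> riemannian_manifold A2 g2 \<and>
     smooth_fun A0 UNIV f1 \<and> (\<forall>x. 0 < f1 x) \<and> smooth_fun A0 UNIV f2 \<and> (\<forall>x. 0 < f2 x)"

definition isometric_immersion ::
    "('n::topological_space, 'f::euclidean_space) chart set \<Rightarrow> 'n metric_field \<Rightarrow>
     ('m::topological_space, 'e::euclidean_space) chart set \<Rightarrow> 'm metric_field \<Rightarrow> ('n \<Rightarrow> 'm) \<Rightarrow> bool" where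
  "isometric_immersion N h A g F \<longleftrightarrow> immersion N A F \<and>
     (\<forall>p. \<forall>u\<in>tangent_space N p. \<forall>v\<in>tangent_space N p.
        g (F p) (push A F p u) (push A F p v) = h p u v)"

definition biwarped_product_submanifold ::
    "('m::{t2_space,second_countable_topology}, 'e::euclidean_space) chart set \<Rightarrow> 'm metric_field \<Rightarrow>
     ('a::{t2_space,second_countable_topology}, 'ea::euclidean_space) chart set \<Rightarrow> 'a metric_field \<Rightarrow>
     ('b::{t2_space,second_countable_topology}, 'eb::euclidean_space) chart set \<Rightarrow> 'b metric_field \<Rightarrow>
     ('c::{t2_space,second_countable_topology}, 'ec::euclidean_space) chart set \<Rightarrow> 'c metric_field \<Rightarrow>
     ('a \<Rightarrow> real) \<Rightarrow> ('a \<Rightarrow> real) \<Rightarrow> ('a \<times> 'b \<times> 'c \<Rightarrow> 'm) \<Rightarrow> bool" where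
  "biwarped_product_submanifold A g A0 g0 A1 g1 A2 g2 f1 f2 F \<longleftrightarrow>
     biwarped_data A0 g0 A1 g1 A2 g2 f1 f2 \<and>
     isometric_immersion (prod_atlas A0 (prod_atlas A1 A2))
       (biwarped_metric A0 g0 A1 g1 A2 g2 f1 f2) A g F"

text \<open>
  Nonexistence of non-trivial biwarped product submanifolds with base \<open>M\<^sub>\<theta>\<close> proper slant and fibres
  \<open>M\<^sub>T\<close> holomorphic, \<open>M\<^sub>\<bottom>\<close> totally real fails if "non-trivial" only means that the two warping
  functions are not both constant: the first can be constant and the second not.  Let \<open>k\<close> be
  positive and different from \<open>1\<close>, and take
  \<open>(\<zeta>, z, t) \<mapsto> (\<zeta> cos t, \<zeta> sin t, k cnj \<zeta>, z)\<close> into flat complex \<open>4\<close>-space, with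
  \<open>\<zeta> \<noteq> 0\<close> complex, \<open>z\<close> complex and \<open>t\<close> real.  The induced metric is
  \<open>(1 + k\<^sup>2) |d\<zeta>|\<^sup>2 + |dz|\<^sup>2 + |\<zeta>|\<^sup>2 dt\<^sup>2\<close> and the slant angle is constant with
  \<open>cos \<theta> = |1 - k\<^sup>2| / (1 + k\<^sup>2)\<close>.  So non-triviality has to include that
  the warping function of the holomorphic factor is non-constant; nothing is then needed of the other.
  Constancy on a whole manifold, as opposed to local constancy, presupposes that the base is connected.
\<close>

end

theory Submission
  imports Defs
begin

text \<open>
  Write \<open>\<omega>(v, w) = g(v, Jw)\<close> for the Kaehler form, which is closed because \<open>J\<close> is parallel for a torsion-free
  metric connection.  On \<open>M\<^sub>\<theta> \<times> M\<^sub>T\<close> (the third factor kept fixed) the pullback of \<open>\<omega>\<close>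
  vanishes on a pair of a base vector and a fibre vector, since \<open>J\<close> preserves the tangent
  spaces of the fibres, which are orthogonal to the base.  Closedness then says
  that the restriction of the pullback to the fibre directions does not change along the base.  This
  restriction is \<open>f(x)\<^sup>2 g\<^sub>T(v, J\<^sub>x w)\<close> with a \<open>g\<^sub>T\<close>-orthogonal \<open>J\<^sub>x\<close>, and
  inserting \<open>v = J\<^sub>x w\<close> gives \<open>f(x)\<^sup>2 \<le> f(x')\<^sup>2\<close> by the Cauchy-Schwarz inequality, for all
  \<open>x, x'\<close> in the connected base.
\<close>

section \<open>Calculus of \<open>C\<^sup>k\<close> maps\<close>

text \<open>What makes the fibre part of \<omega> constant is a count of terms. On constant vectors
  in a chart the exterior derivative of a two-form is the cyclic sum of three directional
  derivatives of its coefficients. For one base vector and two fibre vectors, two of the three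
  summands differentiate a mixed coefficient, which vanishes on an open set, so the third summand,
  the derivative of the fibre part along the base, vanishes as well. This is why everything is
  expressed in charts: closedness in a chart of the ambient manifold, transport along a map between
  open sets of Euclidean spaces, and product charts, in which base and fibre directions are constant
  vectors. Constancy of the fibre part does not yet fix the warping function, because the complex
  structure induced on a fibre tangent space may turn with the base point. The Cauchy-Schwarz
  inequality copes with the turning but gives an inequality only; exchanging the two base points
  makes it an equality.\<close>

lemma frechet_derivative_cong_open:
  assumes "open S" "x \<in> S" "\<And>y. y \<in> S \<Longrightarrow> f y = g y"
  shows "frechet_derivative f (at x) = frechet_derivative g (at x)"
proof -
  \<comment> \<open>\<open>frechet_derivative\<close> is a choice among the derivatives at the
    point. Both functions have the same ones, so the chosen values agree even where there is
    none.\<close>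
  have "(f has_derivative D) (at x) = (g has_derivative D) (at x)" for D
    using assms has_derivative_transform_within_open[of f D x UNIV S g]
      has_derivative_transform_within_open[of g D x UNIV S f] by auto
  then show ?thesis by (simp add: frechet_derivative_def)
qed

lemma differentiable_cong_open:
  assumes "open S" "x \<in> S" "\<And>y. y \<in> S \<Longrightarrow> f y = g y"
  shows "f differentiable (at x) \<longleftrightarrow> g differentiable (at x)"
  using assms has_derivative_transform_within_open[of f _ x UNIV S g]
      has_derivative_transform_within_open[of g _ x UNIV S f]
  unfolding differentiable_def by auto

lemma Ck_on_cong:
  assumes "open S" "\<And>x. x \<in> S \<Longrightarrow> f x = g x"
  shows "Ck_on k S f \<longleftrightarrow> Ck_on k S g"
  using assms(2)
proof (induction k arbitrary: f g)
  case 0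
  then show ?case by (simp cong: continuous_on_cong)
next
  case (Suc k)
  have "Ck_on k S (\<lambda>x. frechet_derivative f (at x) v) = Ck_on k S (\<lambda>x. frechet_derivative g (at x) v)" for v
    by (rule Suc.IH) (simp add: frechet_derivative_cong_open[OF assms(1) _ Suc.prems])
  then show ?case
    using differentiable_cong_open[OF assms(1) _ Suc.prems] by auto
qed

text \<open>The closure properties below go through this rule: the chosen
  \<open>frechet_derivative\<close> is traded for an explicit formula \<open>D\<close>, built from
  lower-order data to which the induction hypothesis applies.\<close>

lemma Ck_on_SucI:
  assumes "open S" "\<And>x. x \<in> S \<Longrightarrow> (f has_derivative D x) (at x)"
    "\<And>v. Ck_on k S (\<lambda>x. D x v)"
  shows "Ck_on (Suc k) S f"
proof -
  have "Ck_on k S (\<lambda>x. frechet_derivative f (at x) v)" for v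
    using Ck_on_cong[OF assms(1), of "\<lambda>x. frechet_derivative f (at x) v" "\<lambda>x. D x v" k]
      frechet_derivative_at[OF assms(2)] assms(3) by metis
  then show ?thesis using assms(2) by (auto simp: differentiable_def)
qed

lemma Ck_on_has_derivative:
  assumes "Ck_on (Suc k) S f" "x \<in> S"
  shows "(f has_derivative frechet_derivative f (at x)) (at x)"
  using assms by (simp add: frechet_derivative_works)

lemma Ck_on_subset: "Ck_on k S f \<Longrightarrow> T \<subseteq> S \<Longrightarrow> Ck_on k T f"
  by (induction k arbitrary: f) (auto intro: continuous_on_subset)

lemma Ck_on_SucD: "Ck_on (Suc k) S f \<Longrightarrow> Ck_on k S f"
proof (induction k arbitrary: f)
  case 0
  then show ?case
    by (auto intro!: continuous_at_imp_continuous_on differentiable_imp_continuous_within)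
next
  case (Suc k)
  then show ?case by (metis Ck_on.simps(2))
qed

text \<open>Needed for compositions of manifold maps, where a formula in coordinates is available
  only near each point, through a chart of the intermediate manifold that changes with the
  point.\<close>

lemma Ck_on_local:
  assumes "\<And>x. x \<in> S \<Longrightarrow> \<exists>T. open T \<and> x \<in> T \<and> Ck_on k T f"
  shows "Ck_on k S f"
  using assms
proof (induction k arbitrary: f)
  case 0
  show ?case
  proof (simp, rule continuous_at_imp_continuous_on, rule ballI)
    fix x assume "x \<in> S"
    then obtain T where "open T" "x \<in> T" "continuous_on T f" using 0 by auto
    then show "isCont f x" by (simp add: continuous_on_eq_continuous_at)
  qed
next
  case (Suc k)
  have "f differentiable (at x)" if "x \<in> S" for x using Suc.prems[OF that] by auto
  moreover have "Ck_on k S (\<lambda>x. frechet_derivative f (at x) v)" for v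
    by (rule Suc.IH) (metis Suc.prems Ck_on.simps(2))
  ultimately show ?case by simp
qed

lemma Ck_on_const: "Ck_on k S (\<lambda>x. c)"
  by (induction k arbitrary: c) (auto simp: frechet_derivative_const)

lemma Ck_on_bounded_linear:
  assumes "open S" "bounded_linear L"
  shows "Ck_on k S L"
proof (cases k)
  case 0
  then show ?thesis using assms(2) by (simp add: linear_continuous_on)
next
  case (Suc n)
  show ?thesis unfolding Suc
    by (rule Ck_on_SucI[OF assms(1) bounded_linear_imp_has_derivative[OF assms(2)]]) (rule Ck_on_const)
qed

lemma Ck_on_linear_compose:
  assumes "open S" "bounded_linear L" "Ck_on k S f"
  shows "Ck_on k S (\<lambda>x. L (f x))"
  using assms(3)
proof (induction k arbitrary: f)
  case 0
  then show ?case
    using continuous_on_compose2[OF linear_continuous_on[OF assms(2), of UNIV], of S f] by auto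
next
  case (Suc k)
  show ?case
    by (rule Ck_on_SucI[OF assms(1) bounded_linear.has_derivative[OF assms(2) Ck_on_has_derivative[OF Suc.prems]]])
       (use Suc in auto)
qed

lemma Ck_on_add:
  assumes "open S" "Ck_on k S f" "Ck_on k S g"
  shows "Ck_on k S (\<lambda>x. f x + g x)"
  using assms(2,3)
proof (induction k arbitrary: f g)
  case 0
  then show ?case by (auto intro: continuous_intros)
next
  case (Suc k)
  show ?case
    by (rule Ck_on_SucI[OF assms(1) has_derivative_add[OF Suc.prems[THEN Ck_on_has_derivative]]])
       (use Suc in auto)
qed

lemma Ck_on_bilinear:
  assumes "open S" "bounded_bilinear B" "Ck_on k S f" "Ck_on k S g"
  shows "Ck_on k S (\<lambda>x. B (f x) (g x))"
  using assms(3,4)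
proof (induction k arbitrary: f g)
  case 0
  then show ?case using bounded_bilinear.continuous_on[OF assms(2)] by auto
next
  case (Suc k)
  \<comment> \<open>In the Leibniz rule each summand keeps one factor undifferentiated, and the
    induction hypothesis wants that factor in the lower class.\<close>
  note lower = Suc.prems[THEN Ck_on_SucD]
  show ?case
    by (rule Ck_on_SucI[OF assms(1) bounded_bilinear.FDERIV[OF assms(2) Suc.prems[THEN Ck_on_has_derivative]]])
       (use Suc lower in \<open>auto intro!: Ck_on_add assms(1)\<close>)
qed

lemma Ck_on_sum:
  assumes "open S" "finite I" "\<And>i. i \<in> I \<Longrightarrow> Ck_on k S (f i)"
  shows "Ck_on k S (\<lambda>x. \<Sum>i\<in>I. f i x)"
  using assms(2,3) by (induction I) (auto intro: Ck_on_const Ck_on_add[OF assms(1)])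

lemma Ck_on_Pair:
  assumes "open S" "Ck_on k S f" "Ck_on k S g"
  shows "Ck_on k S (\<lambda>x. (f x, g x))"
  using assms(2,3)
proof (induction k arbitrary: f g)
  case 0
  then show ?case by (auto intro: continuous_intros)
next
  case (Suc k)
  show ?case
    by (rule Ck_on_SucI[OF assms(1) has_derivative_Pair[OF Suc.prems[THEN Ck_on_has_derivative]]])
       (use Suc in auto)
qed

text \<open>In the chain rule the derivative of \<open>g\<close> is applied to a direction that
  moves with the point. Expanding that direction in the basis leaves partial derivatives of
  \<open>g\<close> in fixed directions, each composed with \<open>f\<close>, with scalar
  coefficients. The induction hypothesis, stated for arbitrary \<open>g\<close>, applies to each of
  them.\<close>

lemma Ck_on_compose:
  fixes f :: "'a::euclidean_space \<Rightarrow> 'b::euclidean_space" and g :: "'b \<Rightarrow> 'c::real_normed_vector"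
  assumes "open S" "f ` S \<subseteq> T" "Ck_on k S f" "Ck_on k T g"
  shows "Ck_on k S (g \<circ> f)"
  using assms(3,4)
proof (induction k arbitrary: g)
  case 0
  then show ?case using assms(2) continuous_on_compose[of S f g] continuous_on_subset[of T g] by (simp add: o_def)
next
  case (Suc k)
  define D where "D x v = (\<Sum>b\<in>Basis.
      (frechet_derivative f (at x) v \<bullet> b) *\<^sub>R ((\<lambda>y. frechet_derivative g (at y) b) \<circ> f) x)" for x v
  show ?case
  proof (rule Ck_on_SucI[OF assms(1), of _ D])
    fix x assume "x \<in> S"
    have f: "(f has_derivative frechet_derivative f (at x)) (at x)"
      using Ck_on_has_derivative[OF Suc.prems(1) \<open>x \<in> S\<close>] .
    have g: "(g has_derivative frechet_derivative g (at (f x))) (at (f x))"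
      using Ck_on_has_derivative[OF Suc.prems(2)] \<open>x \<in> S\<close> assms(2) by auto
    have expand: "frechet_derivative g (at (f x)) w = (\<Sum>b\<in>Basis. (w \<bullet> b) *\<^sub>R frechet_derivative g (at (f x)) b)" for w
    proof -
      have "frechet_derivative g (at (f x)) (\<Sum>b\<in>Basis. (w \<bullet> b) *\<^sub>R b)
          = (\<Sum>b\<in>Basis. (w \<bullet> b) *\<^sub>R frechet_derivative g (at (f x)) b)"
        using has_derivative_linear[OF g] by (simp add: linear_sum linear_cmul)
      then show ?thesis by (simp add: euclidean_representation)
    qed
    have "D x = (\<lambda>v. frechet_derivative g (at (f x)) (frechet_derivative f (at x) v))"
      unfolding D_def[abs_def] o_def by (rule ext) (rule expand[symmetric])
    then show "((g \<circ> f) has_derivative D x) (at x)"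
      using has_derivative_compose[OF f g] by (simp add: o_def)
  next
    fix v
    show "Ck_on k S (\<lambda>x. D x v)" unfolding D_def
    proof (rule Ck_on_sum[OF assms(1) finite_Basis], rule Ck_on_bilinear[OF assms(1) bounded_bilinear_scaleR])
      fix b :: 'b assume "b \<in> Basis"
      have "Ck_on k S (\<lambda>x. frechet_derivative f (at x) v)" using Suc.prems(1) by simp
      then show "Ck_on k S (\<lambda>x. frechet_derivative f (at x) v \<bullet> b)"
        by (rule Ck_on_linear_compose[OF assms(1) bounded_linear_inner_left])
      have "Ck_on k T (\<lambda>y. frechet_derivative g (at y) b)" using Suc.prems(2) by simp
      then show "Ck_on k S ((\<lambda>y. frechet_derivative g (at y) b) \<circ> f)"
        by (rule Suc.IH[OF Ck_on_SucD[OF Suc.prems(1)]])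
    qed
  qed
qed

section \<open>Symmetry of second derivatives\<close>

lemma mixed_partials_double_mvt:
  fixes f :: "'a::euclidean_space \<Rightarrow> real"
  assumes Ck: "Ck_on (Suc (Suc 0)) S f" and h: "0 < h"
    and S: "\<And>s t. 0 \<le> s \<Longrightarrow> s \<le> h \<Longrightarrow> 0 \<le> t \<Longrightarrow> t \<le> h \<Longrightarrow> x + s *\<^sub>R u + t *\<^sub>R v \<in> S"
  obtains s t where "0 < s" "s < h" "0 < t" "t < h"
    "f (x + h *\<^sub>R u + h *\<^sub>R v) - f (x + h *\<^sub>R u) - f (x + h *\<^sub>R v) + f x =
      h * h * frechet_derivative (\<lambda>y. frechet_derivative f (at y) u) (at (x + s *\<^sub>R u + t *\<^sub>R v)) v"
proof -
  define D where "D y = frechet_derivative f (at y) u" for y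
  have f: "(f has_derivative frechet_derivative f (at y)) (at y)" if "y \<in> S" for y
    using Ck_on_has_derivative[OF Ck that] .
  have D: "(D has_derivative frechet_derivative D (at y)) (at y)" if "y \<in> S" for y
    using Ck that unfolding D_def by (simp add: frechet_derivative_works)
  have f_line: "((\<lambda>s. f (x + s *\<^sub>R u + t *\<^sub>R v)) has_real_derivative D (x + s *\<^sub>R u + t *\<^sub>R v)) (at s)"
    if "x + s *\<^sub>R u + t *\<^sub>R v \<in> S" for s t
  proof -
    have "((\<lambda>s. x + s *\<^sub>R u + t *\<^sub>R v) has_derivative (\<lambda>r. r *\<^sub>R u)) (at s)"
      by (auto intro!: derivative_eq_intros)
    from has_derivative_compose[OF this f[OF that]] show ?thesis
      by (simp add: has_field_derivative_def D_def linear_cmul[OF has_derivative_linear[OF f[OF that]]] mult.commute[of _ "frechet_derivative f _ u"])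
  qed
  have D_line: "((\<lambda>t. D (x + s *\<^sub>R u + t *\<^sub>R v)) has_real_derivative
      frechet_derivative D (at (x + s *\<^sub>R u + t *\<^sub>R v)) v) (at t)"
    if "x + s *\<^sub>R u + t *\<^sub>R v \<in> S" for s t
  proof -
    have "((\<lambda>t. x + s *\<^sub>R u + t *\<^sub>R v) has_derivative (\<lambda>r. r *\<^sub>R v)) (at t)"
      by (auto intro!: derivative_eq_intros)
    from has_derivative_compose[OF this D[OF that]] show ?thesis
      by (simp add: has_field_derivative_def linear_cmul[OF has_derivative_linear[OF D[OF that]]] mult.commute[of _ "frechet_derivative D _ v"])
  qed
  \<comment> \<open>The second difference over the parallelogram is
    \<open>\<phi> h - \<phi> 0\<close>. One mean value step in \<open>s\<close> turns it into a
    difference of values of \<open>D\<close>, a second one in \<open>t\<close> into a value of the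
    mixed derivative. The term \<open>0 *\<^sub>R v\<close> is kept to match the two endpoints of
    that second step.\<close>
  define \<phi> where "\<phi> s = f (x + s *\<^sub>R u + h *\<^sub>R v) - f (x + s *\<^sub>R u + 0 *\<^sub>R v)" for s
  have "(\<phi> has_real_derivative D (x + s *\<^sub>R u + h *\<^sub>R v) - D (x + s *\<^sub>R u + 0 *\<^sub>R v)) (at s)"
    if "0 \<le> s" "s \<le> h" for s
    unfolding \<phi>_def using S[OF that, of h] S[OF that, of 0] h by (intro DERIV_diff f_line) auto
  from MVT2[OF h this] obtain s where s: "0 < s" "s < h"
    "\<phi> h - \<phi> 0 = (h - 0) * (D (x + s *\<^sub>R u + h *\<^sub>R v) - D (x + s *\<^sub>R u + 0 *\<^sub>R v))" by auto
  have "((\<lambda>t. D (x + s *\<^sub>R u + t *\<^sub>R v)) has_real_derivative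
      frechet_derivative D (at (x + s *\<^sub>R u + t *\<^sub>R v)) v) (at t)" if "0 \<le> t" "t \<le> h" for t
    using S[of s t] s that by (intro D_line) auto
  from MVT2[OF h this] obtain t where t: "0 < t" "t < h"
    "D (x + s *\<^sub>R u + h *\<^sub>R v) - D (x + s *\<^sub>R u + 0 *\<^sub>R v) =
      (h - 0) * frechet_derivative D (at (x + s *\<^sub>R u + t *\<^sub>R v)) v" by auto
  show thesis
    using that[OF s(1,2) t(1,2)] s(3) t(3) by (simp add: \<phi>_def D_def[abs_def] algebra_simps)
qed

text \<open>Both mixed derivatives, taken at suitable points of a small parallelogram, equal the
  same second difference divided by \<open>h * h\<close>. Continuity moves both points to
  \<open>x\<close> with an error below any \<open>e\<close>.\<close>

lemma second_derivative_symmetric_real: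
  fixes f :: "'a::euclidean_space \<Rightarrow> real"
  assumes "open S" "x \<in> S" and Ck: "Ck_on (Suc (Suc 0)) S f"
  shows "frechet_derivative (\<lambda>y. frechet_derivative f (at y) u) (at x) v =
    frechet_derivative (\<lambda>y. frechet_derivative f (at y) v) (at x) u"
proof -
  define D where "D u v y = frechet_derivative (\<lambda>y. frechet_derivative f (at y) u) (at y) v" for u v y
  have cont: "isCont (D u v) x" for u v
    using Ck assms(1,2) by (auto simp: D_def[abs_def] continuous_on_eq_continuous_at)
  have "\<bar>D u v x - D v u x\<bar> \<le> e" if e: "0 < e" for e
  proof -
    have near: "\<exists>d>0. \<forall>y. dist y x < d \<longrightarrow> \<bar>D u v y - D u v x\<bar> < e / 2" for u v
      using cont[of u v, unfolded continuous_at_eps_delta dist_real_def, rule_format, OF half_gt_zero[OF e]]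
      by blast
    obtain d1 where d1: "d1 > 0" "\<And>y. dist y x < d1 \<Longrightarrow> \<bar>D u v y - D u v x\<bar> < e / 2"
      using near[of u v] by blast
    obtain d2 where d2: "d2 > 0" "\<And>y. dist y x < d2 \<Longrightarrow> \<bar>D v u y - D v u x\<bar> < e / 2"
      using near[of v u] by blast
    obtain d3 where d3: "d3 > 0" "ball x d3 \<subseteq> S" using assms(1,2) openE by blast
    define d where "d = min d1 (min d2 d3)"
    \<comment> \<open>With this side length the whole parallelogram lies in the ball of radius
      \<open>d\<close>; the summand 1 keeps the denominator positive when \<open>u\<close> and
      \<open>v\<close> are both zero.\<close>
    define h where "h = d / (norm u + norm v + 1)"
    have h: "0 < h" unfolding h_def d_def using d1 d2 d3 by (simp add: add_nonneg_pos)
    have close: "dist (x + s *\<^sub>R u + t *\<^sub>R v) x < d" if "0 \<le> s" "s \<le> h" "0 \<le> t" "t \<le> h" for s t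
    proof -
      have "norm (s *\<^sub>R u + t *\<^sub>R v) \<le> h * norm u + h * norm v"
        using that by (intro order_trans[OF norm_triangle_ineq] add_mono) (auto intro: mult_right_mono)
      also have "\<dots> < h * (norm u + norm v + 1)" using h by (simp add: algebra_simps)
      also have "\<dots> = d" by (simp add: h_def add_nonneg_eq_0_iff add_nonneg_pos less_imp_neq[symmetric])
      finally show ?thesis by (simp add: dist_norm add.assoc)
    qed
    have in_S: "x + s *\<^sub>R u + t *\<^sub>R v \<in> S" if "0 \<le> s" "s \<le> h" "0 \<le> t" "t \<le> h" for s t
      using close[OF that] d3(2) by (auto simp: d_def dist_commute)
    obtain s t where st: "0 < s" "s < h" "0 < t" "t < h"
      "f (x + h *\<^sub>R u + h *\<^sub>R v) - f (x + h *\<^sub>R u) - f (x + h *\<^sub>R v) + f x =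
        h * h * D u v (x + s *\<^sub>R u + t *\<^sub>R v)"
      using mixed_partials_double_mvt[OF Ck h, of x u v] in_S unfolding D_def by metis
    have in_S': "x + s *\<^sub>R v + t *\<^sub>R u \<in> S" if "0 \<le> s" "s \<le> h" "0 \<le> t" "t \<le> h" for s t
      using in_S[OF that(3,4,1,2)] by (simp add: algebra_simps)
    obtain s' t' where st': "0 < s'" "s' < h" "0 < t'" "t' < h"
      "f (x + h *\<^sub>R v + h *\<^sub>R u) - f (x + h *\<^sub>R v) - f (x + h *\<^sub>R u) + f x =
        h * h * D v u (x + s' *\<^sub>R v + t' *\<^sub>R u)"
      using mixed_partials_double_mvt[OF Ck h, of x v u] in_S' unfolding D_def by metis
    \<comment> \<open>The second difference is unchanged when \<open>u\<close> and \<open>v\<close>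
      are exchanged; the parameters of the second point appear in swapped order for the same
      reason.\<close>
    have "h * h * D u v (x + s *\<^sub>R u + t *\<^sub>R v) = h * h * D v u (x + t' *\<^sub>R u + s' *\<^sub>R v)"
      using st(5) st'(5) by (simp add: algebra_simps)
    then have "D u v (x + s *\<^sub>R u + t *\<^sub>R v) = D v u (x + t' *\<^sub>R u + s' *\<^sub>R v)"
      using h by simp
    moreover have "\<bar>D u v (x + s *\<^sub>R u + t *\<^sub>R v) - D u v x\<bar> < e / 2"
      using d1(2) close[of s t] st by (simp add: d_def)
    moreover have "\<bar>D v u (x + t' *\<^sub>R u + s' *\<^sub>R v) - D v u x\<bar> < e / 2"
      using d2(2) close[of t' s'] st' by (simp add: d_def)
    ultimately show ?thesis by linarith
  qed
  then have "\<bar>D u v x - D v u x\<bar> \<le> 0" by (rule field_le_epsilon) simp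
  then show ?thesis by (simp add: D_def)
qed

lemma second_derivative_symmetric:
  fixes f :: "'a::euclidean_space \<Rightarrow> 'b::euclidean_space"
  assumes "open S" "x \<in> S" and Ck: "Ck_on (Suc (Suc 0)) S f"
  shows "frechet_derivative (\<lambda>y. frechet_derivative f (at y) u) (at x) v =
    frechet_derivative (\<lambda>y. frechet_derivative f (at y) v) (at x) u"
proof (rule euclidean_eqI)
  fix b :: 'b assume "b \<in> Basis"
  have *: "frechet_derivative (\<lambda>y. f y \<bullet> b) (at y) = (\<lambda>w. frechet_derivative f (at y) w \<bullet> b)" if "y \<in> S" for y
    by (rule frechet_derivative_at[symmetric])
       (rule has_derivative_inner_left[OF Ck_on_has_derivative[OF Ck that]])
  have "frechet_derivative (\<lambda>y. frechet_derivative (\<lambda>y. f y \<bullet> b) (at y) u) (at x) v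
      = frechet_derivative (\<lambda>y. frechet_derivative f (at y) u) (at x) v \<bullet> b" for u v
  proof -
    have "frechet_derivative (\<lambda>y. frechet_derivative (\<lambda>y. f y \<bullet> b) (at y) u) (at x)
      = frechet_derivative (\<lambda>y. frechet_derivative f (at y) u \<bullet> b) (at x)"
      by (rule frechet_derivative_cong_open[OF assms(1,2)]) (simp add: *)
    also have "\<dots> = (\<lambda>v. frechet_derivative (\<lambda>y. frechet_derivative f (at y) u) (at x) v \<bullet> b)"
      using Ck assms(2)
      by (intro frechet_derivative_at[symmetric] has_derivative_inner_left Ck_on_has_derivative[of 0 S]) auto
    finally show ?thesis by (rule fun_cong)
  qed
  moreover have "Ck_on (Suc (Suc 0)) S (\<lambda>y. f y \<bullet> b)"
    by (rule Ck_on_linear_compose[OF assms(1) bounded_linear_inner_left Ck])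
  ultimately show "frechet_derivative (\<lambda>y. frechet_derivative f (at y) u) (at x) v \<bullet> b =
    frechet_derivative (\<lambda>y. frechet_derivative f (at y) v) (at x) u \<bullet> b"
    using second_derivative_symmetric_real[OF assms(1,2)] by metis
qed

section \<open>Two-forms with variable coefficients and their pullbacks\<close>

lemma bilinear_expansion:
  fixes \<omega> :: "'e::euclidean_space \<Rightarrow> 'e \<Rightarrow> real"
  assumes "bilinear \<omega>"
  shows "\<omega> p q = (\<Sum>i\<in>Basis. \<Sum>j\<in>Basis. (p \<bullet> i) * (q \<bullet> j) * \<omega> i j)"
proof -
  have "\<omega> p q = \<omega> (\<Sum>i\<in>Basis. (p \<bullet> i) *\<^sub>R i) (\<Sum>j\<in>Basis. (q \<bullet> j) *\<^sub>R j)"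
    by (simp add: euclidean_representation)
  also have "\<dots> = (\<Sum>i\<in>Basis. \<Sum>j\<in>Basis. (p \<bullet> i) * (q \<bullet> j) * \<omega> i j)"
    using assms
    by (simp add: bilinear_sum sum.cartesian_product[symmetric] bilinear_lmul bilinear_rmul mult.assoc)
  finally show ?thesis .
qed

text \<open>A product rule for three varying things: the form and its two arguments.
  Differentiability of the form is given for fixed arguments only, so everything is expanded into
  the finitely many coefficients on basis vectors and reassembled afterwards. Bilinearity holds on
  \<open>T\<close> alone, hence the restriction to neighbourhoods when the expansion is
  undone.\<close>

lemma has_derivative_bilinear_field:
  fixes \<omega> :: "'e::euclidean_space \<Rightarrow> 'e \<Rightarrow> 'e \<Rightarrow> real" and \<Phi> p q :: "'a::euclidean_space \<Rightarrow> 'e"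
  assumes T: "open T" "\<And>u. u \<in> T \<Longrightarrow> bilinear (\<omega> u)"
    and diff: "\<And>u v w. u \<in> T \<Longrightarrow> (\<lambda>u. \<omega> u v w) differentiable (at u)"
    and N: "open N" "\<Phi> ` N \<subseteq> T" "s \<in> N"
    and \<Phi>: "(\<Phi> has_derivative \<Phi>') (at s)"
    and p: "(p has_derivative p') (at s)" and q: "(q has_derivative q') (at s)"
  shows "((\<lambda>s. \<omega> (\<Phi> s) (p s) (q s)) has_derivative
     (\<lambda>X. frechet_derivative (\<lambda>u. \<omega> u (p s) (q s)) (at (\<Phi> s)) (\<Phi>' X)
        + \<omega> (\<Phi> s) (p' X) (q s) + \<omega> (\<Phi> s) (p s) (q' X))) (at s)"
proof -
  define D where "D i j = frechet_derivative (\<lambda>u. \<omega> u i j) (at (\<Phi> s))" for i j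
  have \<Phi>s: "\<Phi> s \<in> T" using N by auto
  have D: "((\<lambda>u. \<omega> u v w) has_derivative D v w) (at (\<Phi> s))" for v w
    using diff[OF \<Phi>s] unfolding D_def by (simp add: frechet_derivative_works)
  \<comment> \<open>The derivative in the base point is again bilinear in the two arguments, by
    uniqueness of derivatives.\<close>
  have D_expand: "D v w = (\<lambda>X. \<Sum>i\<in>Basis. \<Sum>j\<in>Basis. (v \<bullet> i) * (w \<bullet> j) * D i j X)" for v w
  proof -
    have "((\<lambda>u. \<Sum>i\<in>Basis. \<Sum>j\<in>Basis. (v \<bullet> i) * (w \<bullet> j) * \<omega> u i j) has_derivative
       (\<lambda>X. \<Sum>i\<in>Basis. \<Sum>j\<in>Basis. (v \<bullet> i) * (w \<bullet> j) * D i j X)) (at (\<Phi> s))"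
      by (intro has_derivative_sum has_derivative_mult_right D)
    then have "((\<lambda>u. \<omega> u v w) has_derivative
       (\<lambda>X. \<Sum>i\<in>Basis. \<Sum>j\<in>Basis. (v \<bullet> i) * (w \<bullet> j) * D i j X)) (at (\<Phi> s))"
      by (rule has_derivative_transform_within_open[OF _ T(1) \<Phi>s])
         (simp add: bilinear_expansion[OF T(2), symmetric])
    then show ?thesis using D has_derivative_unique by blast
  qed
  have "((\<lambda>s. \<Sum>i\<in>Basis. \<Sum>j\<in>Basis. (p s \<bullet> i) * (q s \<bullet> j) * \<omega> (\<Phi> s) i j) has_derivative
      (\<lambda>X. \<Sum>i\<in>Basis. \<Sum>j\<in>Basis. (p s \<bullet> i) * (q s \<bullet> j) * D i j (\<Phi>' X) +
        ((p s \<bullet> i) * (q' X \<bullet> j) + (p' X \<bullet> i) * (q s \<bullet> j)) * \<omega> (\<Phi> s) i j)) (at s)"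
    by (intro has_derivative_sum has_derivative_mult has_derivative_inner_left p q
        has_derivative_compose[OF \<Phi> D])
  then have "((\<lambda>s. \<omega> (\<Phi> s) (p s) (q s)) has_derivative
      (\<lambda>X. \<Sum>i\<in>Basis. \<Sum>j\<in>Basis. (p s \<bullet> i) * (q s \<bullet> j) * D i j (\<Phi>' X) +
        ((p s \<bullet> i) * (q' X \<bullet> j) + (p' X \<bullet> i) * (q s \<bullet> j)) * \<omega> (\<Phi> s) i j)) (at s)"
    by (rule has_derivative_transform_within_open[OF _ N(1,3)])
       (use N(2) in \<open>auto simp: bilinear_expansion[OF T(2), symmetric]\<close>)
  also have "(\<lambda>X. \<Sum>i\<in>Basis. \<Sum>j\<in>Basis. (p s \<bullet> i) * (q s \<bullet> j) * D i j (\<Phi>' X) +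
        ((p s \<bullet> i) * (q' X \<bullet> j) + (p' X \<bullet> i) * (q s \<bullet> j)) * \<omega> (\<Phi> s) i j)
     = (\<lambda>X. D (p s) (q s) (\<Phi>' X) + \<omega> (\<Phi> s) (p' X) (q s) + \<omega> (\<Phi> s) (p s) (q' X))"
    unfolding D_expand[of "p s" "q s"]
    by (subst (2 3) bilinear_expansion[OF T(2)[OF \<Phi>s]]) (simp add: sum.distrib algebra_simps)
  finally show ?thesis by (simp add: D_def)
qed

text \<open>The exterior derivative commutes with pullback. In the cyclic sum the first-order terms
  are the closedness relation of \<omega> at the image point. The six terms with a second derivative
  of \<Phi> cancel in pairs, since second derivatives are symmetric and \<omega> is skew.\<close>

lemma pullback_closed:
  fixes \<omega> :: "'e::euclidean_space \<Rightarrow> 'e \<Rightarrow> 'e \<Rightarrow> real" and \<Phi> :: "'a::euclidean_space \<Rightarrow> 'e"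
  assumes T: "open T" "\<And>u. u \<in> T \<Longrightarrow> bilinear (\<omega> u)"
    and skew: "\<And>u v w. u \<in> T \<Longrightarrow> \<omega> u w v = - \<omega> u v w"
    and diff: "\<And>u v w. u \<in> T \<Longrightarrow> (\<lambda>u. \<omega> u v w) differentiable (at u)"
    and closed: "\<And>u x y z. u \<in> T \<Longrightarrow> frechet_derivative (\<lambda>u. \<omega> u y z) (at u) x
        + frechet_derivative (\<lambda>u. \<omega> u z x) (at u) y + frechet_derivative (\<lambda>u. \<omega> u x y) (at u) z = 0"
    and N: "open N" "\<Phi> ` N \<subseteq> T" "s \<in> N" and Ck: "Ck_on (Suc (Suc 0)) N \<Phi>"
  defines "\<Psi> \<equiv> \<lambda>Y Z s. \<omega> (\<Phi> s) (frechet_derivative \<Phi> (at s) Y) (frechet_derivative \<Phi> (at s) Z)"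
  shows "\<Psi> Y Z differentiable (at s)"
    and "frechet_derivative (\<Psi> Y Z) (at s) X + frechet_derivative (\<Psi> Z X) (at s) Y
        + frechet_derivative (\<Psi> X Y) (at s) Z = 0"
proof -
  define d where "d X = frechet_derivative \<Phi> (at s) X" for X
  \<comment> \<open>The Hessian of \<Phi>: \<open>Y\<close> is the direction of the inner
    derivative, \<open>X\<close> that of the outer one.\<close>
  define H where "H X Y = frechet_derivative (\<lambda>y. frechet_derivative \<Phi> (at y) Y) (at s) X" for X Y
  have \<Phi>: "(\<Phi> has_derivative d) (at s)"
    unfolding d_def using Ck_on_has_derivative[OF Ck N(3)] .
  have d: "((\<lambda>s. frechet_derivative \<Phi> (at s) Y) has_derivative (\<lambda>X. H X Y)) (at s)" for Y
    unfolding H_def using Ck N(3) by (intro Ck_on_has_derivative[of 0 N]) auto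
  have *: "(\<Psi> Y Z has_derivative (\<lambda>X. frechet_derivative (\<lambda>u. \<omega> u (d Y) (d Z)) (at (\<Phi> s)) (d X)
        + \<omega> (\<Phi> s) (H X Y) (d Z) + \<omega> (\<Phi> s) (d Y) (H X Z))) (at s)" for Y Z
    unfolding \<Psi>_def d_def[symmetric]
    using has_derivative_bilinear_field[OF T diff N \<Phi> d d] by (simp add: d_def[symmetric])
  show "\<Psi> Y Z differentiable (at s)" using * by (auto simp: differentiable_def)
  have \<Phi>s: "\<Phi> s \<in> T" using N by auto
  have sym: "H X Y = H Y X" for X Y
    unfolding H_def by (rule second_derivative_symmetric[OF N(1,3) Ck])
  have "frechet_derivative (\<Psi> Y Z) (at s) = (\<lambda>X. frechet_derivative (\<lambda>u. \<omega> u (d Y) (d Z)) (at (\<Phi> s)) (d X)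
        + \<omega> (\<Phi> s) (H X Y) (d Z) + \<omega> (\<Phi> s) (d Y) (H X Z))" for Y Z
    using frechet_derivative_at[OF *] by simp
  then show "frechet_derivative (\<Psi> Y Z) (at s) X + frechet_derivative (\<Psi> Z X) (at s) Y
        + frechet_derivative (\<Psi> X Y) (at s) Z = 0"
    using closed[OF \<Phi>s, of "d Y" "d Z" "d X"] skew[OF \<Phi>s, of "H X Y" "d Z"]
      skew[OF \<Phi>s, of "H X Z" "d Y"] skew[OF \<Phi>s, of "H Y Z" "d X"]
    by (simp add: sym[of Y X] sym[of Z X] sym[of Z Y])
qed

section \<open>Charts\<close>

lemma is_chartD:
  assumes "is_chart c"
  shows "open (fst c)" "open (snd c ` fst c)"
    "p \<in> fst c \<Longrightarrow> chart_inv c (snd c p) = p"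
    "u \<in> snd c ` fst c \<Longrightarrow> snd c (chart_inv c u) = u"
    "u \<in> snd c ` fst c \<Longrightarrow> chart_inv c u \<in> fst c"
    "continuous_on (fst c) (snd c)" "continuous_on (snd c ` fst c) (chart_inv c)"
  using assms unfolding is_chart_def homeomorphism_def by auto

lemma chart_image_open:
  assumes "is_chart c" "open V" "V \<subseteq> fst c"
  shows "open (snd c ` V)"
proof -
  have "snd c ` V = (snd c ` fst c) \<inter> chart_inv c -` V"
    using is_chartD[OF assms(1)] assms(3) by force
  then show ?thesis
    using is_chartD[OF assms(1)] continuous_open_preimage assms(2) by metis
qed

lemma atlas_chart: "smooth_atlas A \<Longrightarrow> c \<in> A \<Longrightarrow> is_chart c"
  by (simp add: smooth_atlas_def)

lemma atlas_chart_at: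
  assumes "smooth_atlas A" obtains c where "c \<in> A" "p \<in> fst c"
  using assms unfolding smooth_atlas_def by blast

lemma smooth_on_compose:
  fixes f :: "'a::euclidean_space \<Rightarrow> 'b::euclidean_space" and g :: "'b \<Rightarrow> 'c::real_normed_vector"
  assumes "open S" "f ` S \<subseteq> T" "smooth_on S f" "smooth_on T g"
  shows "smooth_on S (g \<circ> f)"
  using assms Ck_on_compose unfolding smooth_on_def by blast

lemma smooth_on_subset: "smooth_on S f \<Longrightarrow> T \<subseteq> S \<Longrightarrow> smooth_on T f"
  using Ck_on_subset unfolding smooth_on_def by blast

lemma smooth_on_cong:
  "open S \<Longrightarrow> (\<And>x. x \<in> S \<Longrightarrow> f x = g x) \<Longrightarrow> smooth_on S f \<longleftrightarrow> smooth_on S g"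
  using Ck_on_cong unfolding smooth_on_def by blast

lemma smooth_on_local:
  assumes "\<And>x. x \<in> S \<Longrightarrow> \<exists>T. open T \<and> x \<in> T \<and> smooth_on T f"
  shows "smooth_on S f"
  unfolding smooth_on_def
proof
  fix k show "Ck_on k S f"
    by (rule Ck_on_local) (use assms in \<open>auto simp: smooth_on_def\<close>)
qed

lemma smooth_on_bounded_linear: "open S \<Longrightarrow> bounded_linear L \<Longrightarrow> smooth_on S L"
  by (simp add: smooth_on_def Ck_on_bounded_linear)

lemma smooth_on_frechet_derivative:
  assumes "smooth_on S f" shows "smooth_on S (\<lambda>x. frechet_derivative f (at x) v)"
  using assms unfolding smooth_on_def by (metis Ck_on.simps(2))

lemma smooth_on_has_derivative:
  "smooth_on S f \<Longrightarrow> x \<in> S \<Longrightarrow> (f has_derivative frechet_derivative f (at x)) (at x)"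
  using Ck_on_has_derivative unfolding smooth_on_def by blast

lemma transition_smooth:
  assumes "smooth_atlas A" "c \<in> A" "d \<in> A"
  shows "smooth_on (snd c ` (fst c \<inter> fst d)) (snd d \<circ> chart_inv c)"
  using assms by (simp add: smooth_atlas_def)

text \<open>Every other chart sees \<open>h\<close> through a smooth transition map, so one chart
  whose domain contains \<open>V\<close> decides. This is the passage between smoothness on the
  manifold and calculus in coordinates.\<close>

lemma smooth_fun_chart_iff:
  assumes A: "smooth_atlas A" "c \<in> A" and V: "open V" "V \<subseteq> fst c"
  shows "smooth_fun A V h \<longleftrightarrow> smooth_on (snd c ` V) (h \<circ> chart_inv c)"
proof
  assume "smooth_fun A V h"
  then show "smooth_on (snd c ` V) (h \<circ> chart_inv c)"
    using A(2) V(2) unfolding smooth_fun_def by (metis inf.absorb2)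
next
  assume h: "smooth_on (snd c ` V) (h \<circ> chart_inv c)"
  show "smooth_fun A V h" unfolding smooth_fun_def
  proof
    fix d assume d: "d \<in> A"
    note c' = is_chartD[OF atlas_chart[OF A]] and d' = is_chartD[OF atlas_chart[OF A(1) d]]
    have op: "open (snd d ` (fst d \<inter> V))"
      using chart_image_open[OF atlas_chart[OF A(1) d]] V(1) d' by blast
    have "smooth_on (snd d ` (fst d \<inter> V)) (snd c \<circ> chart_inv d)"
      by (rule smooth_on_subset[OF transition_smooth[OF A(1) d A(2)]]) (use V(2) in auto)
    then have "smooth_on (snd d ` (fst d \<inter> V)) ((h \<circ> chart_inv c) \<circ> (snd c \<circ> chart_inv d))"
      by (intro smooth_on_compose[OF op _ _ h]) (use d' in auto)
    then show "smooth_on (snd d ` (fst d \<inter> V)) (h \<circ> chart_inv d)"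
      by (rule smooth_on_cong[OF op, THEN iffD1, rotated]) (use d' c' V(2) in auto)
  qed
qed

lemma smooth_fun_subset:
  assumes "smooth_atlas A" "smooth_fun A U h" "V \<subseteq> U"
  shows "smooth_fun A V h"
  unfolding smooth_fun_def
proof
  fix c assume "c \<in> A"
  then have "smooth_on (snd c ` (fst c \<inter> U)) (h \<circ> chart_inv c)"
    using assms(2) by (simp add: smooth_fun_def)
  then show "smooth_on (snd c ` (fst c \<inter> V)) (h \<circ> chart_inv c)"
    by (rule smooth_on_subset) (use assms(3) in auto)
qed

lemma smooth_near_chart:
  assumes A: "smooth_atlas A" "c \<in> A" "p \<in> fst c" and h: "smooth_near A p h"
  obtains V where "open V" "p \<in> V" "V \<subseteq> fst c" "smooth_on (snd c ` V) (h \<circ> chart_inv c)"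
proof -
  obtain U where U: "open U" "p \<in> U" "smooth_fun A U h" using h unfolding smooth_near_def by auto
  have "open (U \<inter> fst c)" using U(1) is_chartD(1)[OF atlas_chart[OF A(1,2)]] by blast
  moreover have "smooth_fun A (U \<inter> fst c) h" using smooth_fun_subset[OF A(1) U(3)] by blast
  ultimately show thesis
    using that[of "U \<inter> fst c"] smooth_fun_chart_iff[OF A(1,2), of "U \<inter> fst c" h] U A(3) by blast
qed

lemma smooth_near_has_derivative:
  assumes "smooth_atlas A" "c \<in> A" "p \<in> fst c" "smooth_near A p h"
  shows "(h \<circ> chart_inv c has_derivative frechet_derivative (h \<circ> chart_inv c) (at (snd c p))) (at (snd c p))"
proof -
  obtain V where "p \<in> V" "smooth_on (snd c ` V) (h \<circ> chart_inv c)"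
    using smooth_near_chart[OF assms] .
  then show ?thesis by (intro smooth_on_has_derivative) auto
qed

section \<open>Coordinate vector fields\<close>

lemma lincomb_coord_vec:
  assumes "smooth_atlas A" "c \<in> A" "p \<in> fst c"
  shows "lincomb r (coord_vec A c p a) s (coord_vec A c p b) = coord_vec A c p (r *\<^sub>R a + s *\<^sub>R b)"
proof
  fix h
  have "linear (frechet_derivative (h \<circ> chart_inv c) (at (snd c p)))" if "smooth_near A p h"
    using smooth_near_has_derivative[OF assms that] by (rule has_derivative_linear)
  then show "lincomb r (coord_vec A c p a) s (coord_vec A c p b) h = coord_vec A c p (r *\<^sub>R a + s *\<^sub>R b) h"
    by (auto simp: lincomb_def coord_vec_def linear_add linear_cmul)
qed

lemma coord_vec_change:
  assumes A: "smooth_atlas A" "c \<in> A" "p \<in> fst c" "d \<in> A" "p \<in> fst d"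
  shows "coord_vec A c p a = coord_vec A d p (frechet_derivative (snd d \<circ> chart_inv c) (at (snd c p)) a)"
proof
  fix h
  note c' = is_chartD[OF atlas_chart[OF A(1,2)]] and d' = is_chartD[OF atlas_chart[OF A(1,4)]]
  let ?t = "snd d \<circ> chart_inv c"
  have "frechet_derivative (h \<circ> chart_inv c) (at (snd c p)) a =
     frechet_derivative (h \<circ> chart_inv d) (at (snd d p)) (frechet_derivative ?t (at (snd c p)) a)"
    if h: "smooth_near A p h"
  proof -
    have t: "(?t has_derivative frechet_derivative ?t (at (snd c p))) (at (snd c p))"
      using A by (intro smooth_on_has_derivative[OF transition_smooth[OF A(1,2,4)]]) auto
    have "((h \<circ> chart_inv d) has_derivative frechet_derivative (h \<circ> chart_inv d) (at (snd d p))) (at (?t (snd c p)))"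
      using smooth_near_has_derivative[OF A(1,4,5) h] c'(3) A(3) by simp
    from has_derivative_compose[OF t this]
    have "((\<lambda>x. (h \<circ> chart_inv d) (?t x)) has_derivative
      (\<lambda>a. frechet_derivative (h \<circ> chart_inv d) (at (snd d p)) (frechet_derivative ?t (at (snd c p)) a))) (at (snd c p))" .
    then have "(h \<circ> chart_inv c has_derivative
      (\<lambda>a. frechet_derivative (h \<circ> chart_inv d) (at (snd d p)) (frechet_derivative ?t (at (snd c p)) a))) (at (snd c p))"
    proof (rule has_derivative_transform_within_open)
      show "open (snd c ` (fst c \<inter> fst d))"
        using chart_image_open[OF atlas_chart[OF A(1,2)]] c'(1) d'(1) by blast
    qed (use A c'(3) d'(3) in auto)
    then show ?thesis using frechet_derivative_at by metis
  qed
  then show "coord_vec A c p a h = coord_vec A d p (frechet_derivative ?t (at (snd c p)) a) h"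
    by (simp add: coord_vec_def)
qed

lemma coord_vec_tangent: "c \<in> A \<Longrightarrow> p \<in> fst c \<Longrightarrow> coord_vec A c p a \<in> tangent_space A p"
  unfolding tangent_space_def by (rule CollectI, rule exI[of _ c], rule exI[of _ a]) simp

lemma tangent_spaceE:
  assumes "v \<in> tangent_space A p"
  obtains c a where "c \<in> A" "p \<in> fst c" "v = coord_vec A c p a"
  using assms unfolding tangent_space_def by (elim CollectE exE conjE)

text \<open>A tangent vector may come from any chart at \<open>p\<close>. The Jacobian of the
  transition map rewrites it in the chart \<open>c\<close>, so one chart parametrises the whole
  space linearly.\<close>

lemma tangent_space_chart:
  assumes "smooth_atlas A" "c \<in> A" "p \<in> fst c"
  shows "tangent_space A p = range (coord_vec A c p)"
proof
  show "range (coord_vec A c p) \<subseteq> tangent_space A p"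
    using coord_vec_tangent[OF assms(2,3)] by auto
  show "tangent_space A p \<subseteq> range (coord_vec A c p)"
  proof
    fix v assume "v \<in> tangent_space A p"
    then obtain d a where d: "d \<in> A" "p \<in> fst d" and v: "v = coord_vec A d p a"
      by (rule tangent_spaceE)
    show "v \<in> range (coord_vec A c p)"
      unfolding v coord_vec_change[OF assms(1) d assms(2,3)] by (rule rangeI)
  qed
qed

lemma tangent_vec_chart:
  assumes "smooth_atlas A" "c \<in> A" "p \<in> fst c" "v \<in> tangent_space A p"
  obtains a where "v = coord_vec A c p a"
  using assms tangent_space_chart[OF assms(1-3)] by auto

lemma lincomb_tangent:
  assumes A: "smooth_atlas A" and "u \<in> tangent_space A p" "v \<in> tangent_space A p"
  shows "lincomb r u s v \<in> tangent_space A p"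
proof -
  obtain c where c: "c \<in> A" "p \<in> fst c" using atlas_chart_at[OF A] .
  show ?thesis
    using assms(2,3) lincomb_coord_vec[OF A c] unfolding tangent_space_chart[OF A c] by auto
qed

lemma zero_vec_tangent:
  assumes A: "smooth_atlas A" shows "zero_vec \<in> tangent_space A p"
proof -
  obtain c where c: "c \<in> A" "p \<in> fst c" using atlas_chart_at[OF A] .
  have eq: "lincomb 0 (coord_vec A c p 0) 0 (coord_vec A c p 0) = zero_vec"
    by (simp add: zero_vec_def lincomb_def)
  have "lincomb 0 (coord_vec A c p 0) 0 (coord_vec A c p 0) \<in> tangent_space A p"
    by (rule lincomb_tangent[OF A coord_vec_tangent[OF c] coord_vec_tangent[OF c]])
  then show ?thesis unfolding eq .
qed

lemma tangent_not_smooth: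
  assumes "v \<in> tangent_space A p" "\<not> smooth_near A p h" shows "v h = 0"
proof -
  obtain c a where "c \<in> A" "p \<in> fst c" "v = coord_vec A c p a" using assms(1) by (rule tangent_spaceE)
  then show ?thesis using assms(2) by (simp add: coord_vec_def)
qed

lemma coord_vec_nonzero:
  assumes A: "smooth_atlas A" "c \<in> A" "p \<in> fst c" and b: "b \<noteq> 0"
  shows "coord_vec A c p b \<noteq> zero_vec"
proof
  assume 0: "coord_vec A c p b = zero_vec"
  note c' = is_chartD[OF atlas_chart[OF A(1,2)]]
  \<comment> \<open>A test function with derivative \<open>b \<bullet> b > 0\<close> in direction
    \<open>b\<close>. It is controlled only on the domain of \<open>c\<close>, which is enough,
    since tangent vectors ask for smoothness near \<open>p\<close>.\<close>
  define h where "h q = snd c q \<bullet> b" for q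
  have D: "(h \<circ> chart_inv c has_derivative (\<lambda>v. v \<bullet> b)) (at (snd c p))"
    by (rule has_derivative_transform_within_open[OF _ c'(2), of "\<lambda>v. v \<bullet> b"])
       (use A(3) c'(4) in \<open>auto simp: h_def intro!: bounded_linear_imp_has_derivative bounded_linear_inner_left\<close>)
  have "smooth_on (snd c ` fst c) (h \<circ> chart_inv c)"
    using smooth_on_bounded_linear[OF c'(2) bounded_linear_inner_left[of b]]
    by (rule smooth_on_cong[OF c'(2), THEN iffD1, rotated]) (use c'(4) in \<open>auto simp: h_def\<close>)
  then have "smooth_near A p h"
    unfolding smooth_near_def using smooth_fun_chart_iff[OF A(1,2) c'(1)] c'(1) A(3) by blast
  then have "coord_vec A c p b h = b \<bullet> b"
    using frechet_derivative_at[OF D, symmetric] by (simp add: coord_vec_def)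
  then show False using 0 b by (simp add: zero_vec_def)
qed

lemma smooth_fun_coord_vec:
  assumes A: "smooth_atlas A" "c \<in> A" and V: "open V" "V \<subseteq> fst c" "smooth_fun A V h"
  shows "smooth_fun A V (\<lambda>q. coord_vec A c q a h)"
    and "u \<in> snd c ` V \<Longrightarrow> coord_vec A c (chart_inv c u) a h = frechet_derivative (h \<circ> chart_inv c) (at u) a"
proof -
  note c' = is_chartD[OF atlas_chart[OF A]]
  show *: "coord_vec A c (chart_inv c u) a h = frechet_derivative (h \<circ> chart_inv c) (at u) a"
    if "u \<in> snd c ` V" for u
  proof -
    have "chart_inv c u \<in> V" using that V(2) c'(3) by auto
    then have "smooth_near A (chart_inv c u) h" using V unfolding smooth_near_def by blast
    then show ?thesis using that V(2) c'(4) by (auto simp: coord_vec_def)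
  qed
  have "smooth_on (snd c ` V) (\<lambda>u. frechet_derivative (h \<circ> chart_inv c) (at u) a)"
    using V smooth_fun_chart_iff[OF A V(1,2)] by (intro smooth_on_frechet_derivative) auto
  then have "smooth_on (snd c ` V) ((\<lambda>q. coord_vec A c q a h) \<circ> chart_inv c)"
    by (rule smooth_on_cong[OF chart_image_open[OF atlas_chart[OF A] V(1,2)], THEN iffD1, rotated])
       (use * in auto)
  then show "smooth_fun A V (\<lambda>q. coord_vec A c q a h)"
    using smooth_fun_chart_iff[OF A V(1,2)] by blast
qed

lemma vector_field_coord_vec:
  assumes "smooth_atlas A" "c \<in> A"
  shows "vector_field A (fst c) (\<lambda>q. coord_vec A c q a)"
  using assms smooth_fun_coord_vec(1)[OF assms] by (auto simp: vector_field_def coord_vec_tangent)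

text \<open>Symmetry of second derivatives in the guise of commuting fields. It removes the bracket
  terms from the exterior derivative and turns vanishing torsion into a symmetry.\<close>

lemma lie_bracket_coord_vec:
  assumes A: "smooth_atlas A" "c \<in> A" "p \<in> fst c"
  shows "lie_bracket A (\<lambda>q. coord_vec A c q a) (\<lambda>q. coord_vec A c q b) p = zero_vec"
proof
  fix h
  note c' = is_chartD[OF atlas_chart[OF A(1,2)]]
  have "coord_vec A c p a (\<lambda>q. coord_vec A c q b h) = coord_vec A c p b (\<lambda>q. coord_vec A c q a h)"
    if h: "smooth_near A p h"
  proof -
    obtain V where V: "open V" "p \<in> V" "V \<subseteq> fst c" "smooth_on (snd c ` V) (h \<circ> chart_inv c)"
      using smooth_near_chart[OF A h] .
    have Vh: "smooth_fun A V h" using V smooth_fun_chart_iff[OF A(1,2)] by blast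
    have op: "open (snd c ` V)" using chart_image_open[OF atlas_chart[OF A(1,2)] V(1,3)] .
    have p: "snd c p \<in> snd c ` V" using V by auto
    have "coord_vec A c p a (\<lambda>q. coord_vec A c q b h) =
      frechet_derivative (\<lambda>u. frechet_derivative (h \<circ> chart_inv c) (at u) b) (at (snd c p)) a" for a b
    proof -
      have "smooth_near A p (\<lambda>q. coord_vec A c q b h)"
        using smooth_fun_coord_vec(1)[OF A(1,2) V(1,3) Vh] V unfolding smooth_near_def by blast
      moreover have "frechet_derivative ((\<lambda>q. coord_vec A c q b h) \<circ> chart_inv c) (at (snd c p)) =
         frechet_derivative (\<lambda>u. frechet_derivative (h \<circ> chart_inv c) (at u) b) (at (snd c p))"
        using smooth_fun_coord_vec(2)[OF A(1,2) V(1,3) Vh]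
        by (intro frechet_derivative_cong_open[OF op p]) auto
      ultimately show ?thesis by (simp add: coord_vec_def[of A c p a])
    qed
    moreover have "Ck_on (Suc (Suc 0)) (snd c ` V) (h \<circ> chart_inv c)"
      using V(4) unfolding smooth_on_def by (rule spec)
    ultimately show ?thesis
      using second_derivative_symmetric_real[OF op p] by metis
  qed
  then show "lie_bracket A (\<lambda>q. coord_vec A c q a) (\<lambda>q. coord_vec A c q b) p h = zero_vec h"
    by (simp add: lie_bracket_def zero_vec_def)
qed

section \<open>The Kaehler form in a chart\<close>

lemma riemannian_metricD:
  assumes "riemannian_metric A g"
  shows "u \<in> tangent_space A p \<Longrightarrow> v \<in> tangent_space A p \<Longrightarrow> g p u v = g p v u"
    "u \<in> tangent_space A p \<Longrightarrow> v \<in> tangent_space A p \<Longrightarrow> w \<in> tangent_space A p \<Longrightarrow>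
      g p (lincomb a u b v) w = a * g p u w + b * g p v w"
    "u \<in> tangent_space A p \<Longrightarrow> u \<noteq> zero_vec \<Longrightarrow> 0 < g p u u"
    "open U \<Longrightarrow> vector_field A U X \<Longrightarrow> vector_field A U Y \<Longrightarrow> smooth_fun A U (\<lambda>q. g q (X q) (Y q))"
  using assms unfolding riemannian_metric_def by simp_all

lemma riemannian_metric_lincomb_right:
  assumes A: "smooth_atlas A" and g: "riemannian_metric A g"
    and uvw: "u \<in> tangent_space A p" "v \<in> tangent_space A p" "w \<in> tangent_space A p"
  shows "g p w (lincomb a u b v) = a * g p w u + b * g p w v"
  using riemannian_metricD(1)[OF g uvw(3) lincomb_tangent[OF A uvw(1,2)]]
    riemannian_metricD(2)[OF g uvw] riemannian_metricD(1)[OF g uvw(1,3)]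
    riemannian_metricD(1)[OF g uvw(2,3)] by simp

lemma riemannian_metric_zero:
  assumes A: "smooth_atlas A" and g: "riemannian_metric A g" and v: "v \<in> tangent_space A p"
  shows "g p zero_vec v = 0" "g p v zero_vec = 0"
proof -
  have "lincomb 0 v 0 v = zero_vec" by (simp add: lincomb_def zero_vec_def)
  then show "g p zero_vec v = 0" using riemannian_metricD(2)[OF g v v v, of 0 0] by simp
  then show "g p v zero_vec = 0"
    using riemannian_metricD(1)[OF g v zero_vec_tangent[OF A]] by simp
qed

lemma kaehler_manifoldD:
  assumes "kaehler_manifold A J g"
  shows "smooth_atlas A" "riemannian_metric A g"
    "u \<in> tangent_space A p \<Longrightarrow> J p u \<in> tangent_space A p"
    "u \<in> tangent_space A p \<Longrightarrow> v \<in> tangent_space A p \<Longrightarrow>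
      J p (lincomb a u b v) = lincomb a (J p u) b (J p v)"
    "u \<in> tangent_space A p \<Longrightarrow> J p (J p u) = lincomb (-1) u 0 zero_vec"
    "open U \<Longrightarrow> vector_field A U X \<Longrightarrow> vector_field A U (\<lambda>q. J q (X q))"
    "u \<in> tangent_space A p \<Longrightarrow> v \<in> tangent_space A p \<Longrightarrow> g p (J p u) (J p v) = g p u v"
  using assms
  unfolding kaehler_manifold_def riemannian_manifold_def almost_complex_structure_def by simp_all

text \<open>Apply the isometry \<open>J\<close> to both entries and use that its square is minus the
  identity.\<close>

lemma kaehler_J_skew:
  assumes K: "kaehler_manifold A J g" and u: "u \<in> tangent_space A p" and v: "v \<in> tangent_space A p"
  shows "g p u (J p v) = - g p v (J p u)"
proof -
  note K' = kaehler_manifoldD[OF K]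
  have "g p u (J p v) = g p (J p u) (J p (J p v))" using K'(7)[OF u K'(3)[OF v]] by simp
  also have "\<dots> = - g p (J p u) v"
    using riemannian_metric_lincomb_right[OF K'(1,2) v zero_vec_tangent[OF K'(1)] K'(3)[OF u], of "-1" 0]
    by (simp add: K'(5)[OF v])
  finally show ?thesis using riemannian_metricD(1)[OF K'(2) K'(3)[OF u] v] by simp
qed

lemma levi_civitaD:
  assumes "levi_civita A g nabla"
  shows "affine_connection A nabla"
    "open U \<Longrightarrow> vector_field A U X \<Longrightarrow> vector_field A U Y \<Longrightarrow> p \<in> U \<Longrightarrow>
      lincomb 1 (nabla p (X p) Y) (-1) (nabla p (Y p) X) = lie_bracket A X Y p"
    "open U \<Longrightarrow> vector_field A U Y \<Longrightarrow> vector_field A U Z \<Longrightarrow> p \<in> U \<Longrightarrow> u \<in> tangent_space A p \<Longrightarrow>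
      u (\<lambda>q. g q (Y q) (Z q)) = g p (nabla p u Y) (Z p) + g p (Y p) (nabla p u Z)"
  using assms unfolding levi_civita_def by simp_all

text \<open>The coefficients of \<omega> in the chart \<open>c\<close>, as a family of forms on the
  model space, so that the Euclidean pullback calculus applies. The values are meaningful only for
  \<open>u\<close> in the chart image, where \<open>chart_inv\<close> inverts the coordinate
  map.\<close>

definition chart_kaehler_form ::
    "('m::topological_space, 'e::euclidean_space) chart set \<Rightarrow> ('m \<Rightarrow> 'm tvec \<Rightarrow> 'm tvec) \<Rightarrow>
     'm metric_field \<Rightarrow> ('m, 'e) chart \<Rightarrow> 'e \<Rightarrow> 'e \<Rightarrow> 'e \<Rightarrow> real" where
  "chart_kaehler_form A J g c u v w =
     (let p = chart_inv c u in g p (coord_vec A c p v) (J p (coord_vec A c p w)))"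

context
  fixes A :: "('m::{t2_space,second_countable_topology}, 'e::euclidean_space) chart set"
    and J g and c :: "('m, 'e) chart" and u :: 'e
  assumes K: "kaehler_manifold A J g" and c: "c \<in> A" and u: "u \<in> snd c ` fst c"
begin

private abbreviation (input) "p \<equiv> chart_inv c u"
private abbreviation (input) "X a \<equiv> \<lambda>q. coord_vec A c q a"

private lemma p: "p \<in> fst c" "snd c p = u"
  using is_chartD(4,5)[OF atlas_chart[OF kaehler_manifoldD(1)[OF K] c] u] by auto

private lemma X: "X a p \<in> tangent_space A p"
  using coord_vec_tangent[OF c p(1)] .

lemma chart_kaehler_form_bilinear: "bilinear (chart_kaehler_form A J g c u)"
proof -
  note K' = kaehler_manifoldD[OF K] and lin = lincomb_coord_vec[OF kaehler_manifoldD(1)[OF K] c p(1), symmetric]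
  have add: "coord_vec A c p (a + b) = lincomb 1 (X a p) 1 (X b p)" for a b
    using lin[of 1 a 1 b] by simp
  have scale: "coord_vec A c p (r *\<^sub>R a) = lincomb r (X a p) 0 (X a p)" for a r
    using lin[of r a 0 a] by simp
  show ?thesis unfolding bilinear_def
    by (intro conjI allI linearI)
       (simp_all add: chart_kaehler_form_def Let_def add scale K'(4)[OF X X] riemannian_metricD(2)[OF K'(2) X X]
         riemannian_metric_lincomb_right[OF K'(1,2)] X K'(3))
qed

lemma chart_kaehler_form_skew: "chart_kaehler_form A J g c u b a = - chart_kaehler_form A J g c u a b"
  unfolding chart_kaehler_form_def Let_def by (rule kaehler_J_skew[OF K X X])

private lemma form_field: "chart_kaehler_form A J g c = (\<lambda>u a b. ((\<lambda>q. g q (X a q) (J q (X b q))) \<circ> chart_inv c) u)"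
  by (simp add: chart_kaehler_form_def fun_eq_iff Let_def)

private lemma open_c: "open (fst c)"
  using is_chartD(1)[OF atlas_chart[OF kaehler_manifoldD(1)[OF K] c]] .

private lemma J_field: "vector_field A (fst c) (\<lambda>q. J q (X b q))"
  using kaehler_manifoldD(6)[OF K open_c vector_field_coord_vec[OF kaehler_manifoldD(1)[OF K] c]] .

private lemma smooth_form: "smooth_fun A (fst c) (\<lambda>q. g q (X a q) (J q (X b q)))"
  using riemannian_metricD(4)[OF kaehler_manifoldD(2)[OF K] open_c
      vector_field_coord_vec[OF kaehler_manifoldD(1)[OF K] c] J_field] .

lemma chart_kaehler_form_differentiable:
  "(\<lambda>u. chart_kaehler_form A J g c u a b) differentiable (at u)"
proof -
  have "smooth_on (snd c ` fst c) ((\<lambda>q. g q (X a q) (J q (X b q))) \<circ> chart_inv c)"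
    using smooth_form smooth_fun_chart_iff[OF kaehler_manifoldD(1)[OF K] c open_c] by blast
  from differentiableI[OF smooth_on_has_derivative[OF this u]] show ?thesis
    by (simp add: form_field o_def)
qed

text \<open>Let \<open>N a b\<close> be the covariant derivative of the coordinate field
  \<open>b\<close> along the field \<open>a\<close>, an invariant form of the Christoffel symbols.
  Metric compatibility and parallelism of \<open>J\<close> express each directional derivative of
  \<omega> through two of these vectors. Symmetry of \<open>N\<close>, which is vanishing torsion on
  commuting fields, cancels the six terms of the cyclic sum.\<close>

lemma chart_kaehler_form_closed:
  "frechet_derivative (\<lambda>u. chart_kaehler_form A J g c u y z) (at u) x
   + frechet_derivative (\<lambda>u. chart_kaehler_form A J g c u z x) (at u) y
   + frechet_derivative (\<lambda>u. chart_kaehler_form A J g c u x y) (at u) z = 0"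
proof -
  note K' = kaehler_manifoldD[OF K] and field = vector_field_coord_vec[OF kaehler_manifoldD(1)[OF K] c]
  obtain nabla where lc: "levi_civita A g nabla"
    and par: "\<And>U Y p u. open U \<Longrightarrow> vector_field A U Y \<Longrightarrow> p \<in> U \<Longrightarrow> u \<in> tangent_space A p \<Longrightarrow>
           nabla p u (\<lambda>q. J q (Y q)) = J p (nabla p u Y)"
    using K unfolding kaehler_manifold_def by auto
  define N where "N a b = nabla p (X a p) (X b)" for a b
  have N: "N a b \<in> tangent_space A p" for a b
  proof -
    note levi_civitaD(1)[OF lc]
    then show ?thesis unfolding N_def using open_c field p(1) X by (simp add: affine_connection_def)
  qed
  have sym: "N a b = N b a" for a b
  proof
    fix h
    have "lincomb 1 (N a b) (-1) (N b a) = lie_bracket A (X a) (X b) p"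
      unfolding N_def by (rule levi_civitaD(2)[OF lc open_c field field p(1)])
    also have "\<dots> = zero_vec" by (rule lie_bracket_coord_vec[OF K'(1) c p(1)])
    finally have "lincomb 1 (N a b) (-1) (N b a) h = zero_vec h" by simp
    then show "N a b h = N b a h" by (simp add: lincomb_def zero_vec_def)
  qed
  \<comment> \<open>The minus sign comes from skewness, used to bring the second term into the shape
    of the first, with \<open>N\<close> in the left entry.\<close>
  have D: "frechet_derivative (\<lambda>u. chart_kaehler_form A J g c u b d) (at u) a =
      g p (N a b) (J p (X d p)) - g p (N a d) (J p (X b p))" for a b d
  proof -
    have "frechet_derivative (\<lambda>u. chart_kaehler_form A J g c u b d) (at u) a =
        X a p (\<lambda>q. g q (X b q) (J q (X d q)))"
      using smooth_fun_coord_vec(2)[OF K'(1) c open_c subset_refl smooth_form u]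
      by (simp add: form_field o_def)
    also have "\<dots> = g p (N a b) (J p (X d p)) + g p (X b p) (nabla p (X a p) (\<lambda>q. J q (X d q)))"
      unfolding N_def by (rule levi_civitaD(3)[OF lc open_c field J_field p(1) X])
    also have "nabla p (X a p) (\<lambda>q. J q (X d q)) = J p (N a d)"
      unfolding N_def using par[OF open_c field p(1) X] .
    finally show ?thesis using kaehler_J_skew[OF K X N, of b a d] by simp
  qed
  show ?thesis unfolding D by (simp add: sym[of y x] sym[of z x] sym[of z y])
qed

end

section \<open>Smooth maps and differentials\<close>

lemma smooth_map_domain_open:
  assumes "smooth_atlas A" "smooth_atlas B" "smooth_map A B F" "c \<in> A" "d \<in> B"
  shows "open (fst c \<inter> F -` fst d)" "open (snd c ` (fst c \<inter> F -` fst d))"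
proof -
  have "open (fst c)" "open (fst d)"
    using is_chartD(1) atlas_chart assms by blast+
  then show *: "open (fst c \<inter> F -` fst d)"
    using assms(3) open_vimage unfolding smooth_map_def by blast
  show "open (snd c ` (fst c \<inter> F -` fst d))"
    by (rule chart_image_open[OF atlas_chart[OF assms(1,4)] *]) auto
qed

lemma smooth_map_chart:
  assumes "smooth_map A B F" "c \<in> A" "d \<in> B"
  shows "smooth_on (snd c ` (fst c \<inter> F -` fst d)) (snd d \<circ> F \<circ> chart_inv c)"
  using assms by (simp add: smooth_map_def)

text \<open>Ensures that \<open>push\<close> evaluates a tangent vector on a genuine test function:
  whenever the guard in \<open>push\<close> holds, \<open>h \<circ> F\<close> is smooth near
  \<open>p\<close>, so the default value 0 of \<open>coord_vec\<close> does not interfere.\<close>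

lemma smooth_near_compose:
  assumes A: "smooth_atlas A" and B: "smooth_atlas B" and F: "smooth_map A B F"
    and h: "smooth_near B (F p) h"
  shows "smooth_near A p (h \<circ> F)"
proof -
  obtain c where c: "c \<in> A" "p \<in> fst c" using atlas_chart_at[OF A] .
  obtain d where d: "d \<in> B" "F p \<in> fst d" using atlas_chart_at[OF B] .
  obtain V where V: "open V" "F p \<in> V" "V \<subseteq> fst d" "smooth_on (snd d ` V) (h \<circ> chart_inv d)"
    using smooth_near_chart[OF B d h] .
  define W where "W = fst c \<inter> F -` V"
  have "continuous_on UNIV F" using F by (simp add: smooth_map_def)
  then have W: "open W" "W \<subseteq> fst c" "p \<in> W"
    using V(1,2) c(2) is_chartD(1)[OF atlas_chart[OF A c(1)]] open_vimage[of V F] unfolding W_def by auto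
  have op: "open (snd c ` W)" using chart_image_open[OF atlas_chart[OF A c(1)] W(1,2)] .
  note c' = is_chartD[OF atlas_chart[OF A c(1)]] and d' = is_chartD[OF atlas_chart[OF B d(1)]]
  have WV: "F q \<in> V" "q \<in> fst c" "F q \<in> fst d" if "q \<in> W" for q using that V(3) by (auto simp: W_def)
  have "smooth_on (snd c ` W) (snd d \<circ> F \<circ> chart_inv c)"
    by (rule smooth_on_subset[OF smooth_map_chart[OF F c(1) d(1)]]) (use WV in auto)
  then have "smooth_on (snd c ` W) ((h \<circ> chart_inv d) \<circ> (snd d \<circ> F \<circ> chart_inv c))"
    by (intro smooth_on_compose[OF op _ _ V(4)]) (use WV c'(3) in auto)
  then have "smooth_on (snd c ` W) ((h \<circ> F) \<circ> chart_inv c)"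
    by (rule smooth_on_cong[OF op, THEN iffD1, rotated]) (use WV c'(3) d'(3) in auto)
  then have "smooth_fun A W (h \<circ> F)" using smooth_fun_chart_iff[OF A c(1) W(1,2)] by simp
  then show ?thesis using W unfolding smooth_near_def by auto
qed

lemma push_coord_vec:
  assumes A: "smooth_atlas A" and B: "smooth_atlas B" and F: "smooth_map A B F"
    and c: "c \<in> A" "p \<in> fst c" and d: "d \<in> B" "F p \<in> fst d"
  shows "push B F p (coord_vec A c p a) =
    coord_vec B d (F p) (frechet_derivative (snd d \<circ> F \<circ> chart_inv c) (at (snd c p)) a)"
proof
  fix h
  let ?t = "snd d \<circ> F \<circ> chart_inv c"
  note c' = is_chartD[OF atlas_chart[OF A c(1)]] and d' = is_chartD[OF atlas_chart[OF B d(1)]]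
  have "coord_vec A c p a (h \<circ> F) =
     frechet_derivative (h \<circ> chart_inv d) (at (snd d (F p))) (frechet_derivative ?t (at (snd c p)) a)"
    if h: "smooth_near B (F p) h"
  proof -
    have t: "(?t has_derivative frechet_derivative ?t (at (snd c p))) (at (snd c p))"
      using c d by (intro smooth_on_has_derivative[OF smooth_map_chart[OF F c(1) d(1)]]) auto
    have "((h \<circ> chart_inv d) has_derivative frechet_derivative (h \<circ> chart_inv d) (at (snd d (F p)))) (at (?t (snd c p)))"
      using smooth_near_has_derivative[OF B d h] c'(3) c(2) by simp
    from has_derivative_compose[OF t this]
    have "((h \<circ> F) \<circ> chart_inv c has_derivative
      (\<lambda>a. frechet_derivative (h \<circ> chart_inv d) (at (snd d (F p))) (frechet_derivative ?t (at (snd c p)) a))) (at (snd c p))"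
      by (rule has_derivative_transform_within_open[OF _ smooth_map_domain_open(2)[OF A B F c(1) d(1)]])
         (use c d c'(3) d'(3) in auto)
    from frechet_derivative_at[OF this, symmetric] show ?thesis
      using smooth_near_compose[OF A B F h] by (simp add: coord_vec_def)
  qed
  then show "push B F p (coord_vec A c p a) h =
      coord_vec B d (F p) (frechet_derivative ?t (at (snd c p)) a) h"
    by (simp add: push_def coord_vec_def[of B])
qed

lemma push_tangent:
  assumes A: "smooth_atlas A" and B: "smooth_atlas B" and F: "smooth_map A B F"
    and v: "v \<in> tangent_space A p"
  shows "push B F p v \<in> tangent_space B (F p)"
proof -
  obtain c where c: "c \<in> A" "p \<in> fst c" using atlas_chart_at[OF A] .
  obtain d where d: "d \<in> B" "F p \<in> fst d" using atlas_chart_at[OF B] .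
  obtain a where "v = coord_vec A c p a" using tangent_vec_chart[OF A c v] .
  then show ?thesis
    using push_coord_vec[OF A B F c d] coord_vec_tangent[OF d] by simp
qed

text \<open>For operators on functions, functoriality is associativity of composition. The only
  point is agreement of the guards: a function smooth near \<open>G (F p)\<close> stays smooth near
  \<open>F p\<close> when composed with \<open>G\<close>.\<close>

lemma push_compose:
  assumes B: "smooth_atlas B" and C: "smooth_atlas C" and G: "smooth_map B C G"
  shows "push C G (F p) (push B F p v) = push C (\<lambda>x. G (F x)) p v"
  using smooth_near_compose[OF B C G, of "F p"] by (auto simp: push_def fun_eq_iff o_def)

text \<open>On functions not smooth near \<open>p\<close> both sides are 0, by the convention on
  tangent vectors; this is where tangency of \<open>v\<close> enters.\<close>

lemma push_id:
  assumes "v \<in> tangent_space A p"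
  shows "push A (\<lambda>x. x) p v = v"
proof
  fix h show "push A (\<lambda>x. x) p v h = v h"
    using tangent_not_smooth[OF assms, of h] by (simp add: push_def o_def)
qed

lemma push_const:
  assumes "v \<in> tangent_space A p"
  shows "push B (\<lambda>x. k) p v = zero_vec"
proof
  fix h
  obtain c a where "c \<in> A" "p \<in> fst c" "v = coord_vec A c p a" using assms by (rule tangent_spaceE)
  then have "v (\<lambda>x. h k) = 0" by (simp add: coord_vec_def o_def frechet_derivative_const)
  then show "push B (\<lambda>x. k) p v h = zero_vec h" by (simp add: push_def o_def zero_vec_def)
qed

lemma smooth_map_id:
  assumes "smooth_atlas A" shows "smooth_map A A (\<lambda>x. x)"
  using transition_smooth[OF assms] by (simp add: smooth_map_def o_def)

lemma smooth_map_const: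
  shows "smooth_map A B (\<lambda>x. k)"
  by (simp add: smooth_map_def o_def smooth_on_def Ck_on_const)

lemma smooth_map_compose:
  assumes A: "smooth_atlas A" and B: "smooth_atlas B" and C: "smooth_atlas C"
    and F: "smooth_map A B F" and G: "smooth_map B C G"
  shows "smooth_map A C (\<lambda>x. G (F x))"
  unfolding smooth_map_def
proof (intro conjI ballI)
  show cont: "continuous_on UNIV (\<lambda>x. G (F x))"
    using F G continuous_on_compose2[of UNIV G UNIV F] by (simp add: smooth_map_def)
  fix c e assume c: "c \<in> A" and e: "e \<in> C"
  note c' = is_chartD[OF atlas_chart[OF A c]]
  show "smooth_on (snd c ` (fst c \<inter> (\<lambda>x. G (F x)) -` fst e)) (snd e \<circ> (\<lambda>x. G (F x)) \<circ> chart_inv c)"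
  proof (rule smooth_on_local)
    fix s assume "s \<in> snd c ` (fst c \<inter> (\<lambda>x. G (F x)) -` fst e)"
    then obtain p where p: "p \<in> fst c" "G (F p) \<in> fst e" "s = snd c p" by auto
    \<comment> \<open>No single chart of the middle manifold need contain the image of the domain of
      \<open>c\<close>, so the composition is examined on the part \<open>W\<close> that passes
      through one chart at \<open>F p\<close>.\<close>
    obtain d where d: "d \<in> B" "F p \<in> fst d" using atlas_chart_at[OF B] .
    note d' = is_chartD[OF atlas_chart[OF B d(1)]]
    define W where "W = (fst c \<inter> F -` fst d) \<inter> (\<lambda>x. G (F x)) -` fst e"
    have "open W" unfolding W_def
      by (rule open_Int[OF smooth_map_domain_open(1)[OF A B F c d(1)]
            open_vimage[OF is_chartD(1)[OF atlas_chart[OF C e]] cont]])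
    then have op: "open (snd c ` W)"
      by (rule chart_image_open[OF atlas_chart[OF A c]]) (auto simp: W_def)
    have W: "q \<in> fst c" "F q \<in> fst d" "G (F q) \<in> fst e" if "q \<in> W" for q using that by (auto simp: W_def)
    have "smooth_on (snd c ` W) (snd d \<circ> F \<circ> chart_inv c)"
      by (rule smooth_on_subset[OF smooth_map_chart[OF F c d(1)]]) (use W in auto)
    then have "smooth_on (snd c ` W) ((snd e \<circ> G \<circ> chart_inv d) \<circ> (snd d \<circ> F \<circ> chart_inv c))"
      by (intro smooth_on_compose[OF op _ _ smooth_map_chart[OF G d(1) e]]) (use W c'(3) in auto)
    then have "smooth_on (snd c ` W) (snd e \<circ> (\<lambda>x. G (F x)) \<circ> chart_inv c)"
      by (rule smooth_on_cong[OF op, THEN iffD1, rotated]) (use W c'(3) d'(3) in auto)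
    moreover have "s \<in> snd c ` W" using p d by (auto simp: W_def)
    ultimately show "\<exists>T. open T \<and> s \<in> T \<and> smooth_on T (snd e \<circ> (\<lambda>x. G (F x)) \<circ> chart_inv c)"
      using op by auto
  qed
qed

section \<open>Products of manifolds\<close>

text \<open>The members of \<open>prod_atlas\<close>, with the coordinate map written by projections
  instead of \<open>map_prod\<close>.\<close>

definition prod_chart :: "('a, 'e) chart \<Rightarrow> ('b, 'f) chart \<Rightarrow> ('a \<times> 'b, 'e \<times> 'f) chart" where
  "prod_chart c d = (fst c \<times> fst d, \<lambda>q. (snd c (fst q), snd d (snd q)))"

lemma prod_atlas_eq: "prod_atlas A B = (\<lambda>z. prod_chart (fst z) (snd z)) ` (A \<times> B)"
  unfolding prod_atlas_def prod_chart_def by (rule image_cong) (auto simp: fun_eq_iff)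

lemma prod_atlasI: "c \<in> A \<Longrightarrow> d \<in> B \<Longrightarrow> prod_chart c d \<in> prod_atlas A B"
  unfolding prod_atlas_eq by (rule image_eqI[of _ _ "(c, d)"]) simp_all

lemma prod_atlasE:
  assumes "e \<in> prod_atlas A B"
  obtains c d where "e = prod_chart c d" "c \<in> A" "d \<in> B"
proof -
  obtain z where "e = prod_chart (fst z) (snd z)" "z \<in> A \<times> B"
    using assms unfolding prod_atlas_eq by (rule imageE)
  then show thesis using that[of "fst z" "snd z"] by (simp add: mem_Times_iff)
qed

text \<open>\<open>chart_inv\<close> is a chosen inverse, so the componentwise formula holds only on
  the chart image, where injectivity determines the choice.\<close>

lemma chart_inv_prod_chart:
  assumes c: "is_chart c" and d: "is_chart d" and s: "s \<in> snd c ` fst c" and t: "t \<in> snd d ` fst d"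
  shows "chart_inv (prod_chart c d) (s, t) = (chart_inv c s, chart_inv d t)"
proof -
  note c' = is_chartD[OF c] and d' = is_chartD[OF d]
  have "inj_on (snd (prod_chart c d)) (fst (prod_chart c d))"
    by (rule inj_on_inverseI[where g = "\<lambda>z. (chart_inv c (fst z), chart_inv d (snd z))"])
       (auto simp: prod_chart_def c' d')
  then show ?thesis unfolding chart_inv_def[of "prod_chart c d"]
    by (rule inv_into_f_eq) (use c' d' s t in \<open>auto simp: prod_chart_def\<close>)
qed

lemma prod_chart_image: "snd (prod_chart c d) ` (S \<times> T) = (snd c ` S) \<times> (snd d ` T)"
proof (intro equalityI subsetI)
  fix z assume "z \<in> (snd c ` S) \<times> (snd d ` T)"
  then obtain x y where "x \<in> S" "y \<in> T" "z = (snd c x, snd d y)" by auto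
  then show "z \<in> snd (prod_chart c d) ` (S \<times> T)"
    by (intro image_eqI[of _ _ "(x, y)"]) (auto simp: prod_chart_def)
qed (auto simp: prod_chart_def)

lemma is_chart_prod_chart:
  assumes c: "is_chart c" and d: "is_chart d"
  shows "is_chart (prod_chart c d)"
proof -
  note c' = is_chartD[OF c] and d' = is_chartD[OF d]
  have dom: "fst (prod_chart c d) = fst c \<times> fst d" by (simp add: prod_chart_def)
  have inv: "chart_inv (prod_chart c d) z = (chart_inv c (fst z), chart_inv d (snd z))"
    if "z \<in> (snd c ` fst c) \<times> (snd d ` fst d)" for z
    using chart_inv_prod_chart[OF c d, of "fst z" "snd z"] that by auto
  have "continuous_on ((snd c ` fst c) \<times> (snd d ` fst d)) (\<lambda>z. (chart_inv c (fst z), chart_inv d (snd z)))"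
    by (intro continuous_on_Pair continuous_on_compose2[OF c'(7)] continuous_on_compose2[OF d'(7)]
        continuous_on_fst continuous_on_snd continuous_on_id) auto
  then have 1: "continuous_on ((snd c ` fst c) \<times> (snd d ` fst d)) (chart_inv (prod_chart c d))"
    using inv by (simp cong: continuous_on_cong)
  have 2: "continuous_on (fst c \<times> fst d) (snd (prod_chart c d))"
    unfolding prod_chart_def snd_conv
    by (intro continuous_on_Pair continuous_on_compose2[OF c'(6)] continuous_on_compose2[OF d'(6)]
        continuous_on_fst continuous_on_snd continuous_on_id) auto
  have "homeomorphism (fst c \<times> fst d) ((snd c ` fst c) \<times> (snd d ` fst d))
      (snd (prod_chart c d)) (chart_inv (prod_chart c d))"
    by (rule homeomorphismI[OF 2 1])
       (use inv c' d' in \<open>auto simp: prod_chart_image prod_chart_def\<close>)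
  then show ?thesis
    unfolding is_chart_def dom prod_chart_image using c' d' by (simp add: open_Times)
qed

lemma smooth_on_Pair:
  "open S \<Longrightarrow> smooth_on S f \<Longrightarrow> smooth_on S g \<Longrightarrow> smooth_on S (\<lambda>x. (f x, g x))"
  by (simp add: smooth_on_def Ck_on_Pair)

lemma smooth_on_fst_snd:
  fixes f :: "'a::euclidean_space \<Rightarrow> 'c::real_normed_vector" and g :: "'b::euclidean_space \<Rightarrow> 'd::real_normed_vector"
  assumes "open S" "open T"
  shows "smooth_on S f \<Longrightarrow> smooth_on (S \<times> T) (\<lambda>z. f (fst z))"
    and "smooth_on T g \<Longrightarrow> smooth_on (S \<times> T) (\<lambda>z. g (snd z))"
proof -
  note op = open_Times[OF assms]
  show "smooth_on (S \<times> T) (\<lambda>z. f (fst z))" if "smooth_on S f"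
    using smooth_on_compose[OF op _ smooth_on_bounded_linear[OF op bounded_linear_fst] that]
    by (auto simp: o_def)
  show "smooth_on (S \<times> T) (\<lambda>z. g (snd z))" if "smooth_on T g"
    using smooth_on_compose[OF op _ smooth_on_bounded_linear[OF op bounded_linear_snd] that]
    by (auto simp: o_def)
qed

lemma smooth_atlas_prod:
  assumes A: "smooth_atlas A" and B: "smooth_atlas B"
  shows "smooth_atlas (prod_atlas A B)"
  unfolding smooth_atlas_def
proof (intro conjI ballI)
  show "is_chart e" if "e \<in> prod_atlas A B" for e
    using that by (rule prod_atlasE) (simp add: is_chart_prod_chart atlas_chart[OF A] atlas_chart[OF B])
  show "(\<Union>c\<in>prod_atlas A B. fst c) = UNIV"
  proof (rule UNIV_eq_I[symmetric])
    fix q :: "'a \<times> 'c"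
    obtain c where c: "c \<in> A" "fst q \<in> fst c" using atlas_chart_at[OF A] .
    obtain d where d: "d \<in> B" "snd q \<in> fst d" using atlas_chart_at[OF B] .
    have "q \<in> fst (prod_chart c d)" using c d by (simp add: prod_chart_def mem_Times_iff)
    then show "q \<in> (\<Union>c\<in>prod_atlas A B. fst c)" by (rule UN_I[OF prod_atlasI[OF c(1) d(1)]])
  qed
  fix e e' assume e_in: "e \<in> prod_atlas A B" and e'_in: "e' \<in> prod_atlas A B"
  obtain c d where e: "e = prod_chart c d" and cd: "c \<in> A" "d \<in> B"
    using e_in by (rule prod_atlasE)
  obtain c' d' where e': "e' = prod_chart c' d'" and cd': "c' \<in> A" "d' \<in> B"
    using e'_in by (rule prod_atlasE)
  note cD = is_chartD[OF atlas_chart[OF A cd(1)]] and dD = is_chartD[OF atlas_chart[OF B cd(2)]]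
  define S where "S = snd c ` (fst c \<inter> fst c')"
  define T where "T = snd d ` (fst d \<inter> fst d')"
  have op: "open S" "open T" unfolding S_def T_def
    using is_chartD(1)[OF atlas_chart[OF A cd'(1)]] is_chartD(1)[OF atlas_chart[OF B cd'(2)]] cD(1) dD(1)
    by (auto intro!: chart_image_open[OF atlas_chart[OF A cd(1)]] chart_image_open[OF atlas_chart[OF B cd(2)]])
  have dom: "snd e ` (fst e \<inter> fst e') = S \<times> T"
    using prod_chart_image[of c d "fst c \<inter> fst c'" "fst d \<inter> fst d'"]
    by (simp add: e e' S_def T_def prod_chart_def Times_Int_Times)
  have "smooth_on (S \<times> T) (\<lambda>z. ((snd c' \<circ> chart_inv c) (fst z), (snd d' \<circ> chart_inv d) (snd z)))"
    using transition_smooth[OF A cd(1) cd'(1)] transition_smooth[OF B cd(2) cd'(2)]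
    unfolding S_def[symmetric] T_def[symmetric]
    by (intro smooth_on_Pair smooth_on_fst_snd open_Times op)
  then show "smooth_on (snd e ` (fst e \<inter> fst e')) (snd e' \<circ> chart_inv e)"
    unfolding dom
  proof (rule smooth_on_cong[OF open_Times[OF op], THEN iffD1, rotated])
    fix z assume "z \<in> S \<times> T"
    then have "chart_inv e (fst z, snd z) = (chart_inv c (fst z), chart_inv d (snd z))"
      unfolding e by (intro chart_inv_prod_chart atlas_chart[OF A cd(1)] atlas_chart[OF B cd(2)])
        (auto simp: S_def T_def)
    then show "((snd c' \<circ> chart_inv c) (fst z), (snd d' \<circ> chart_inv d) (snd z)) = (snd e' \<circ> chart_inv e) z"
      by (simp add: e' prod_chart_def)
  qed
qed

lemma smooth_map_fst:
  assumes A: "smooth_atlas A" and B: "smooth_atlas B"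
  shows "smooth_map (prod_atlas A B) A fst"
  unfolding smooth_map_def
proof (intro conjI ballI)
  show "continuous_on UNIV fst" by (intro continuous_intros)
  fix e c' assume e_in: "e \<in> prod_atlas A B" and c': "c' \<in> A"
  obtain c d where e: "e = prod_chart c d" and c: "c \<in> A" and d: "d \<in> B"
    using e_in by (rule prod_atlasE)
  define S where "S = snd c ` (fst c \<inter> fst c')"
  have op: "open S" "open (snd d ` fst d)" unfolding S_def
    using is_chartD(1)[OF atlas_chart[OF A c]] is_chartD(1)[OF atlas_chart[OF A c']] is_chartD(2)[OF atlas_chart[OF B d]]
    by (auto intro!: chart_image_open[OF atlas_chart[OF A c]])
  have "fst e \<inter> fst -` fst c' = (fst c \<inter> fst c') \<times> fst d"
    by (auto simp: e prod_chart_def)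
  then have dom: "snd e ` (fst e \<inter> fst -` fst c') = S \<times> (snd d ` fst d)"
    by (simp only: e S_def prod_chart_image)
  have "smooth_on (S \<times> (snd d ` fst d)) (\<lambda>z. (snd c' \<circ> chart_inv c) (fst z))"
    using transition_smooth[OF A c c'] unfolding S_def[symmetric] by (rule smooth_on_fst_snd(1)[OF op])
  then show "smooth_on (snd e ` (fst e \<inter> fst -` fst c')) (snd c' \<circ> fst \<circ> chart_inv e)"
    unfolding dom
  proof (rule smooth_on_cong[OF open_Times[OF op], THEN iffD1, rotated])
    fix z assume "z \<in> S \<times> (snd d ` fst d)"
    then have "chart_inv e (fst z, snd z) = (chart_inv c (fst z), chart_inv d (snd z))"
      unfolding e by (intro chart_inv_prod_chart atlas_chart[OF A c] atlas_chart[OF B d])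
        (auto simp: S_def)
    then show "(snd c' \<circ> chart_inv c) (fst z) = (snd c' \<circ> fst \<circ> chart_inv e) z" by simp
  qed
qed

lemma smooth_map_snd:
  assumes A: "smooth_atlas A" and B: "smooth_atlas B"
  shows "smooth_map (prod_atlas A B) B snd"
  unfolding smooth_map_def
proof (intro conjI ballI)
  show "continuous_on UNIV snd" by (intro continuous_intros)
  fix e d' assume e_in: "e \<in> prod_atlas A B" and d': "d' \<in> B"
  obtain c d where e: "e = prod_chart c d" and c: "c \<in> A" and d: "d \<in> B"
    using e_in by (rule prod_atlasE)
  define T where "T = snd d ` (fst d \<inter> fst d')"
  have op: "open (snd c ` fst c)" "open T" unfolding T_def
    using is_chartD(1)[OF atlas_chart[OF B d]] is_chartD(1)[OF atlas_chart[OF B d']] is_chartD(2)[OF atlas_chart[OF A c]]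
    by (auto intro!: chart_image_open[OF atlas_chart[OF B d]])
  have "fst e \<inter> snd -` fst d' = fst c \<times> (fst d \<inter> fst d')"
    by (auto simp: e prod_chart_def)
  then have dom: "snd e ` (fst e \<inter> snd -` fst d') = (snd c ` fst c) \<times> T"
    by (simp only: e T_def prod_chart_image)
  have "smooth_on ((snd c ` fst c) \<times> T) (\<lambda>z. (snd d' \<circ> chart_inv d) (snd z))"
    using transition_smooth[OF B d d'] unfolding T_def[symmetric] by (rule smooth_on_fst_snd(2)[OF op])
  then show "smooth_on (snd e ` (fst e \<inter> snd -` fst d')) (snd d' \<circ> snd \<circ> chart_inv e)"
    unfolding dom
  proof (rule smooth_on_cong[OF open_Times[OF op], THEN iffD1, rotated])
    fix z assume "z \<in> (snd c ` fst c) \<times> T"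
    then have "chart_inv e (fst z, snd z) = (chart_inv c (fst z), chart_inv d (snd z))"
      unfolding e by (intro chart_inv_prod_chart atlas_chart[OF A c] atlas_chart[OF B d])
        (auto simp: T_def)
    then show "(snd d' \<circ> chart_inv d) (snd z) = (snd d' \<circ> snd \<circ> chart_inv e) z" by simp
  qed
qed

lemma smooth_map_Pair:
  assumes A: "smooth_atlas A" and B: "smooth_atlas B" and C: "smooth_atlas C"
    and F: "smooth_map A B F" and G: "smooth_map A C G"
  shows "smooth_map A (prod_atlas B C) (\<lambda>x. (F x, G x))"
  unfolding smooth_map_def
proof (intro conjI ballI)
  show "continuous_on UNIV (\<lambda>x. (F x, G x))"
    using F G by (simp add: smooth_map_def continuous_on_Pair)
  fix c e assume c: "c \<in> A" and e_in: "e \<in> prod_atlas B C"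
  obtain d d' where e: "e = prod_chart d d'" and d: "d \<in> B" "d' \<in> C"
    using e_in by (rule prod_atlasE)
  define S where "S = snd c ` ((fst c \<inter> F -` fst d) \<inter> (fst c \<inter> G -` fst d'))"
  have dom: "snd c ` (fst c \<inter> (\<lambda>x. (F x, G x)) -` fst e) = S"
    unfolding S_def by (rule arg_cong[of _ _ "(`) (snd c)"]) (auto simp: e prod_chart_def)
  have op: "open S" unfolding S_def
    by (rule chart_image_open[OF atlas_chart[OF A c] open_Int[OF smooth_map_domain_open(1)[OF A B F c d(1)]
        smooth_map_domain_open(1)[OF A C G c d(2)]]]) auto
  have "smooth_on S (snd d \<circ> F \<circ> chart_inv c)" "smooth_on S (snd d' \<circ> G \<circ> chart_inv c)"
    using smooth_on_subset[OF smooth_map_chart[OF F c d(1)], of S]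
      smooth_on_subset[OF smooth_map_chart[OF G c d(2)], of S] by (auto simp: S_def)
  from smooth_on_Pair[OF op this]
  show "smooth_on (snd c ` (fst c \<inter> (\<lambda>x. (F x, G x)) -` fst e)) (snd e \<circ> (\<lambda>x. (F x, G x)) \<circ> chart_inv c)"
    unfolding dom by (simp add: e prod_chart_def o_def)
qed

text \<open>In coordinates a slice is an affine embedding with derivative
  \<open>a \<mapsto> (a, 0)\<close>. Thus vectors tangent to the first factor become constant
  vectors of the product chart, which is the form in which the closedness relation is
  evaluated.\<close>

lemma push_slice_fst:
  assumes A: "smooth_atlas A" and B: "smooth_atlas B" and c: "c \<in> A" "x \<in> fst c" and d: "d \<in> B" "y \<in> fst d"
  shows "push (prod_atlas A B) (\<lambda>x. (x, y)) x (coord_vec A c x a) =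
    coord_vec (prod_atlas A B) (prod_chart c d) (x, y) (a, 0)"
proof -
  note c' = is_chartD[OF atlas_chart[OF A c(1)]]
  have "((snd (prod_chart c d) \<circ> (\<lambda>x. (x, y)) \<circ> chart_inv c) has_derivative (\<lambda>a. (a, 0))) (at (snd c x))"
    by (rule has_derivative_transform_within_open[OF _ c'(2), of "\<lambda>s. (s, snd d y)"])
       (use c c'(4) in \<open>auto simp: prod_chart_def intro!: derivative_eq_intros\<close>)
  from frechet_derivative_at[OF this, symmetric] show ?thesis
    by (subst push_coord_vec[OF A smooth_atlas_prod[OF A B] _ c, of _ "prod_chart c d"])
       (use A B c d in \<open>auto simp: prod_chart_def[of c d, THEN arg_cong[of _ _ fst]]
          intro!: prod_atlasI smooth_map_Pair smooth_map_id smooth_map_const\<close>)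
qed

lemma push_slice_snd:
  assumes A: "smooth_atlas A" and B: "smooth_atlas B" and c: "c \<in> A" "x \<in> fst c" and d: "d \<in> B" "y \<in> fst d"
  shows "push (prod_atlas A B) (\<lambda>y. (x, y)) y (coord_vec B d y b) =
    coord_vec (prod_atlas A B) (prod_chart c d) (x, y) (0, b)"
proof -
  note d' = is_chartD[OF atlas_chart[OF B d(1)]]
  have "((snd (prod_chart c d) \<circ> (\<lambda>y. (x, y)) \<circ> chart_inv d) has_derivative (\<lambda>b. (0, b))) (at (snd d y))"
    by (rule has_derivative_transform_within_open[OF _ d'(2), of "\<lambda>t. (snd c x, t)"])
       (use d d'(4) in \<open>auto simp: prod_chart_def intro!: derivative_eq_intros\<close>)
  from frechet_derivative_at[OF this, symmetric] show ?thesis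
    by (subst push_coord_vec[OF B smooth_atlas_prod[OF A B] _ d, of _ "prod_chart c d"])
       (use A B c d in \<open>auto simp: prod_chart_def[of c d, THEN arg_cong[of _ _ fst]]
          intro!: prod_atlasI smooth_map_Pair smooth_map_id smooth_map_const\<close>)
qed

section \<open>Independence of the Kaehler form of the base point\<close>

context
  fixes A :: "('m::{t2_space,second_countable_topology}, 'e::euclidean_space) chart set" and J g
    and A0 :: "('a::{t2_space,second_countable_topology}, 'ea::euclidean_space) chart set" and g0
    and A1 :: "('b::{t2_space,second_countable_topology}, 'eb::euclidean_space) chart set" and g1
    and A2 :: "('c::{t2_space,second_countable_topology}, 'ec::euclidean_space) chart set" and g2
    and f \<sigma> F
  assumes K: "kaehler_manifold A J g"
    and biwarped: "biwarped_product_submanifold A g A0 g0 A1 g1 A2 g2 f \<sigma> F"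
    and holomorphic: "\<And>x z. holomorphic_submanifold A1 A J (\<lambda>y. F (x, y, z))"
begin

section \<open>Base and fibre directions of the biwarped product\<close>

private lemma atlases: "smooth_atlas A" "smooth_atlas A0" "smooth_atlas A1" "smooth_atlas A2"
  and metrics: "riemannian_metric A0 g0" "riemannian_metric A1 g1" "riemannian_metric A2 g2"
  using biwarped kaehler_manifoldD(1)[OF K]
  by (simp_all add: biwarped_product_submanifold_def biwarped_data_def riemannian_manifold_def)

private abbreviation (input) "N \<equiv> prod_atlas A0 (prod_atlas A1 A2)"

private lemma N: "smooth_atlas N"
  by (intro smooth_atlas_prod atlases)

private lemma F_smooth: "smooth_map N A F"
  and F_isometric: "u \<in> tangent_space N p \<Longrightarrow> v \<in> tangent_space N p \<Longrightarrow>
    g (F p) (push A F p u) (push A F p v) = biwarped_metric A0 g0 A1 g1 A2 g2 f \<sigma> p u v"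
  using biwarped
  by (simp_all add: biwarped_product_submanifold_def isometric_immersion_def immersion_def
      del: split_paired_All)

private lemma inclusions:
  "smooth_map A0 N (\<lambda>x. (x, y, z))" "smooth_map A1 N (\<lambda>y. (x, y, z))"
  by (intro smooth_map_Pair smooth_map_id smooth_map_const smooth_atlas_prod atlases)+

private lemma projections:
  "smooth_map N A0 fst" "smooth_map N A1 (fst \<circ> snd)" "smooth_map N A2 (snd \<circ> snd)"
  unfolding o_def
  by (intro smooth_map_fst smooth_map_snd smooth_atlas_prod atlases
      smooth_map_compose[where B = "prod_atlas A1 A2"] N)+

text \<open>A base vector is carried into the product along a slice. Following the slice by a
  projection gives the identity or a constant map, so exactly one component survives in the biwarped
  metric.\<close>

private lemma push_base:
  fixes y :: 'b and z :: 'c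
  assumes u: "u \<in> tangent_space A0 x"
  defines "u' \<equiv> push N (\<lambda>x. (x, y, z)) x u"
  shows "u' \<in> tangent_space N (x, y, z)"
    "push A F (x, y, z) u' = push A (\<lambda>x. F (x, y, z)) x u"
    "push A0 fst (x, y, z) u' = u"
    "push A1 (fst \<circ> snd) (x, y, z) u' = zero_vec"
    "push A2 (snd \<circ> snd) (x, y, z) u' = zero_vec"
proof -
  note compose = push_compose[OF N _ _, where F = "\<lambda>x. (x, y, z)" and p = x and v = u]
  show "u' \<in> tangent_space N (x, y, z)"
    unfolding u'_def by (rule push_tangent[OF atlases(2) N inclusions(1) u])
  show "push A F (x, y, z) u' = push A (\<lambda>x. F (x, y, z)) x u"
    unfolding u'_def by (rule compose[OF atlases(1) F_smooth])
  show "push A0 fst (x, y, z) u' = u"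
    unfolding u'_def using compose[OF atlases(2) projections(1)] push_id[OF u] by simp
  show "push A1 (fst \<circ> snd) (x, y, z) u' = zero_vec"
    unfolding u'_def using compose[OF atlases(3) projections(2)] push_const[OF u] by simp
  show "push A2 (snd \<circ> snd) (x, y, z) u' = zero_vec"
    unfolding u'_def using compose[OF atlases(4) projections(3)] push_const[OF u] by simp
qed

private lemma push_fibre:
  fixes x :: 'a and z :: 'c
  assumes v: "v \<in> tangent_space A1 y"
  defines "v' \<equiv> push N (\<lambda>y. (x, y, z)) y v"
  shows "v' \<in> tangent_space N (x, y, z)"
    "push A F (x, y, z) v' = push A (\<lambda>y. F (x, y, z)) y v"
    "push A0 fst (x, y, z) v' = zero_vec"
    "push A1 (fst \<circ> snd) (x, y, z) v' = v"
    "push A2 (snd \<circ> snd) (x, y, z) v' = zero_vec"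
proof -
  note compose = push_compose[OF N _ _, where F = "\<lambda>y. (x, y, z)" and p = y and v = v]
  show "v' \<in> tangent_space N (x, y, z)"
    unfolding v'_def by (rule push_tangent[OF atlases(3) N inclusions(2) v])
  show "push A F (x, y, z) v' = push A (\<lambda>y. F (x, y, z)) y v"
    unfolding v'_def by (rule compose[OF atlases(1) F_smooth])
  show "push A0 fst (x, y, z) v' = zero_vec"
    unfolding v'_def using compose[OF atlases(2) projections(1)] push_const[OF v] by simp
  show "push A1 (fst \<circ> snd) (x, y, z) v' = v"
    unfolding v'_def using compose[OF atlases(3) projections(2)] push_id[OF v] by simp
  show "push A2 (snd \<circ> snd) (x, y, z) v' = zero_vec"
    unfolding v'_def using compose[OF atlases(4) projections(3)] push_const[OF v] by simp
qed

private abbreviation (input) "dF1 x y z \<equiv> push A (\<lambda>y. F (x, y, z)) y"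

private lemma fibre_metric:
  assumes "v \<in> tangent_space A1 y" "w \<in> tangent_space A1 y"
  shows "g (F (x, y, z)) (dF1 x y z v) (dF1 x y z w) = (f x)\<^sup>2 * g1 y v w"
  using F_isometric[OF push_fibre(1)[OF assms(1), of x z] push_fibre(1)[OF assms(2)]]
  by (simp add: biwarped_metric_def Let_def push_fibre(2-5)[OF assms(1)] push_fibre(2-5)[OF assms(2)]
      riemannian_metric_zero[OF atlases(2) metrics(1) zero_vec_tangent[OF atlases(2)]]
      riemannian_metric_zero[OF atlases(4) metrics(3) zero_vec_tangent[OF atlases(4)]])

text \<open>The two vectors live in different factors, so each summand of the biwarped metric has a
  zero entry.\<close>

private lemma base_fibre_orthogonal:
  assumes "u \<in> tangent_space A0 x" "v \<in> tangent_space A1 y"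
  shows "g (F (x, y, z)) (push A (\<lambda>x. F (x, y, z)) x u) (dF1 x y z v) = 0"
  using F_isometric[OF push_base(1)[OF assms(1)] push_fibre(1)[OF assms(2), of x z]]
  by (simp add: biwarped_metric_def Let_def push_base(2-5)[OF assms(1)] push_fibre(2-5)[OF assms(2)]
      riemannian_metric_zero[OF atlases(2) metrics(1) assms(1)]
      riemannian_metric_zero[OF atlases(3) metrics(2) assms(2)]
      riemannian_metric_zero[OF atlases(4) metrics(3) zero_vec_tangent[OF atlases(4)]])

text \<open>The vector \<open>v'\<close> is \<open>J\<^sub>x v\<close> of the overview. It depends
  on \<open>x\<close> and \<open>z\<close>, since \<open>J\<close> is read through the immersion of
  the fibre over these points.\<close>

private lemma fibre_rotate:
  assumes "v \<in> tangent_space A1 y"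
  obtains v' where "v' \<in> tangent_space A1 y" "J (F (x, y, z)) (dF1 x y z v) = dF1 x y z v'"
proof -
  have "J (F (x, y, z)) ` dF1 x y z ` tangent_space A1 y \<subseteq> dF1 x y z ` tangent_space A1 y"
    using holomorphic[of x z] unfolding holomorphic_submanifold_def submanifold_tangent_def by blast
  then have "J (F (x, y, z)) (dF1 x y z v) \<in> dF1 x y z ` tangent_space A1 y"
    using assms by auto
  then show thesis using that by auto
qed

text \<open>\<open>J\<close> preserves \<open>g\<close>, and both image vectors carry the same
  factor \<open>(f x)\<^sup>2\<close>, which cancels. The induced rotation is therefore orthogonal
  for the unwarped fibre metric.\<close>

private lemma fibre_rotate_norm:
  assumes f: "0 < f x" and v: "v \<in> tangent_space A1 y" and v': "v' \<in> tangent_space A1 y"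
    and J: "J (F (x, y, z)) (dF1 x y z v) = dF1 x y z v'"
  shows "g1 y v' v' = g1 y v v"
proof -
  have "dF1 x y z v \<in> tangent_space A (F (x, y, z))"
    using push_tangent[OF N atlases(1) F_smooth push_fibre(1)[OF v]] push_fibre(2)[OF v] by simp
  from kaehler_manifoldD(7)[OF K this this]
  have "(f x)\<^sup>2 * g1 y v' v' = (f x)\<^sup>2 * g1 y v v"
    by (simp add: J fibre_metric[OF v v] fibre_metric[OF v' v'])
  then show ?thesis using f by simp
qed

text \<open>The pulled-back form is evaluated in a product chart on constant vectors, one along the
  base and two along the fibre. Closedness leaves only the base derivative of \<omega>, and a ball
  in the base chart is convex, so a vanishing derivative there means a constant.\<close>

private lemma fibre_form_locally_constant:
  fixes x0 :: 'a and z :: 'c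
  assumes v: "v \<in> tangent_space A1 y" and w: "w \<in> tangent_space A1 y"
  defines "\<omega> x \<equiv> g (F (x, y, z)) (dF1 x y z v) (J (F (x, y, z)) (dF1 x y z w))"
  shows "\<exists>U. open U \<and> x0 \<in> U \<and> (\<forall>x\<in>U. \<omega> x = \<omega> x0)"
proof -
  define P where "P = prod_atlas A0 A1"
  \<comment> \<open>Freezing \<open>z\<close> leaves a map on the product of base and holomorphic
    fibre.\<close>
  define G where "G q = F (fst q, snd q, z)" for q
  have P: "smooth_atlas P" unfolding P_def by (intro smooth_atlas_prod atlases)
  have "smooth_map P N (\<lambda>q. (fst q, snd q, z))" unfolding P_def
    by (intro smooth_map_Pair smooth_map_fst smooth_map_snd smooth_map_const smooth_atlas_prod atlases)
  then have G: "smooth_map P A G"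
    using smooth_map_compose[OF P N atlases(1) _ F_smooth] by (simp add: G_def[abs_def])
  obtain c where c: "c \<in> A0" "x0 \<in> fst c" using atlas_chart_at[OF atlases(2)] .
  obtain d where d: "d \<in> A1" "y \<in> fst d" using atlas_chart_at[OF atlases(3)] .
  obtain e where e: "e \<in> A" "F (x0, y, z) \<in> fst e" using atlas_chart_at[OF atlases(1)] .
  obtain b1 where b1: "v = coord_vec A1 d y b1" using tangent_vec_chart[OF atlases(3) d v] .
  obtain b2 where b2: "w = coord_vec A1 d y b2" using tangent_vec_chart[OF atlases(3) d w] .
  note c' = is_chartD[OF atlas_chart[OF atlases(2) c(1)]]
    and d' = is_chartD[OF atlas_chart[OF atlases(3) d(1)]]
    and e' = is_chartD[OF atlas_chart[OF atlases(1) e(1)]]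
  define k where "k = prod_chart c d"
  have k: "k \<in> P" unfolding k_def P_def using c d by (intro prod_atlasI)
  note k' = is_chartD[OF atlas_chart[OF P k]]
  \<comment> \<open>The part of the product chart domain that \<open>G\<close> sends into the chart
    \<open>e\<close>. It need not be a product set, so the base neighbourhood is cut out later as a
    ball in the slice at \<open>t\<close>.\<close>
  define D where "D = fst k \<inter> G -` fst e"
  define S where "S = snd k ` D"
  define \<Phi> where "\<Phi> = snd e \<circ> G \<circ> chart_inv k"
  have S: "open S" unfolding S_def D_def using smooth_map_domain_open(2)[OF P atlases(1) G k e(1)] .
  have \<Phi>: "smooth_on S \<Phi>" unfolding \<Phi>_def S_def D_def using smooth_map_chart[OF G k e(1)] .
  have \<Phi>_at: "\<Phi> (snd k q) = snd e (G q)" "chart_inv e (snd e (G q)) = G q" if "q \<in> D" for q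
    using that k'(3) e'(3) by (auto simp: \<Phi>_def D_def)
  have image: "\<Phi> ` S \<subseteq> snd e ` fst e"
    using \<Phi>_at by (auto simp: S_def D_def)
  define \<eta> where "\<eta> = chart_kaehler_form A J g e"
  define \<Psi> where "\<Psi> Y Z s = \<eta> (\<Phi> s) (frechet_derivative \<Phi> (at s) Y) (frechet_derivative \<Phi> (at s) Z)" for Y Z s
  note \<eta> = chart_kaehler_form_bilinear[OF K e(1)] chart_kaehler_form_skew[OF K e(1)]
    chart_kaehler_form_differentiable[OF K e(1)] chart_kaehler_form_closed[OF K e(1)]
  have Ck: "Ck_on (Suc (Suc 0)) S \<Phi>" using \<Phi> unfolding smooth_on_def by (rule spec)
  have pullback_differentiable: "\<Psi> Y Z differentiable (at s)" if "s \<in> S" for Y Z s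
    unfolding \<Psi>_def[abs_def] \<eta>_def
    by (rule pullback_closed(1)[OF e'(2) \<eta> S image that Ck])
  have pullback: "frechet_derivative (\<Psi> Y Z) (at s) X + frechet_derivative (\<Psi> Z X) (at s) Y
      + frechet_derivative (\<Psi> X Y) (at s) Z = 0" if "s \<in> S" for X Y Z s
    unfolding \<Psi>_def[abs_def] \<eta>_def
    by (rule pullback_closed(2)[OF e'(2) \<eta> S image that Ck])
  have \<Psi>_skew: "\<Psi> Z Y s = - \<Psi> Y Z s" if "s \<in> S" for Y Z s
    unfolding \<Psi>_def \<eta>_def by (rule \<eta>(2)) (use that image in auto)
  have push_G: "coord_vec A e (G q) (frechet_derivative \<Phi> (at (snd k q)) Y) = push A G q (coord_vec P k q Y)"
    if "q \<in> D" for q Y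
    unfolding \<Phi>_def using that by (intro push_coord_vec[OF P atlases(1) G k _ e(1), symmetric]) (auto simp: D_def)
  have \<Psi>_push: "\<Psi> Y Z (snd k q) =
      g (G q) (push A G q (coord_vec P k q Y)) (J (G q) (push A G q (coord_vec P k q Z)))"
    if "q \<in> D" for q Y Z
    unfolding \<Psi>_def \<eta>_def chart_kaehler_form_def Let_def \<Phi>_at[OF that] push_G[OF that] ..
  have D_dom: "x' \<in> fst c" "y' \<in> fst d" if "(x', y') \<in> D" for x' y'
    using that by (auto simp: D_def k_def prod_chart_def)
  have base: "push A G (x', y') (coord_vec P k (x', y') (a, 0)) = push A (\<lambda>x. F (x, y', z)) x' (coord_vec A0 c x' a)"
    if "(x', y') \<in> D" for x' y' a
    using push_slice_fst[OF atlases(2,3) c(1) D_dom(1)[OF that] d(1) D_dom(2)[OF that], of a, symmetric]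
      push_compose[OF P atlases(1) G, of "\<lambda>x. (x, y')" x' "coord_vec A0 c x' a"]
    by (simp add: k_def P_def G_def)
  have fibre: "push A G (x', y') (coord_vec P k (x', y') (0, b)) = dF1 x' y' z (coord_vec A1 d y' b)"
    if "(x', y') \<in> D" for x' y' b
    using push_slice_snd[OF atlases(2,3) c(1) D_dom(1)[OF that] d(1) D_dom(2)[OF that], of b, symmetric]
      push_compose[OF P atlases(1) G, of "\<lambda>y. (x', y)" y' "coord_vec A1 d y' b"]
    by (simp add: k_def P_def G_def)
  \<comment> \<open>\<open>J\<close> turns the fibre vector into another fibre vector, which is
    orthogonal to the base. The claim is made on all of \<open>S\<close>, not only over
    \<open>y\<close>, because the mixed coefficients are differentiated in fibre directions.\<close>
  have mixed: "\<Psi> (a, 0) (0, b) s = 0" if s: "s \<in> S" for a b s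
  proof -
    obtain q where "q \<in> D" "s = snd k q" using s unfolding S_def by (elim imageE)
    then obtain x' y' where q: "(x', y') \<in> D" "s = snd k (x', y')" by (metis surj_pair)
    note tangent = coord_vec_tangent[OF d(1) D_dom(2)[OF q(1)], of b]
    obtain v' where v': "v' \<in> tangent_space A1 y'"
      "J (F (x', y', z)) (dF1 x' y' z (coord_vec A1 d y' b)) = dF1 x' y' z v'"
      using fibre_rotate[OF tangent] .
    show ?thesis
      unfolding q(2) \<Psi>_push[OF q(1)] base[OF q(1)] fibre[OF q(1)]
      using v'(2) base_fibre_orthogonal[OF coord_vec_tangent[OF c(1) D_dom(1)[OF q(1)]] v'(1)]
      by (simp add: G_def)
  qed
  have mixed': "\<Psi> (0, b) (a, 0) s = 0" if "s \<in> S" for a b s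
    using \<Psi>_skew[OF that, of "(0, b)" "(a, 0)"] mixed[OF that] by simp
  have zero: "frechet_derivative \<Theta> (at s) = (\<lambda>_. 0)"
    if "s \<in> S" "\<And>s. s \<in> S \<Longrightarrow> \<Theta> s = 0" for \<Theta> :: "'ea \<times> 'eb \<Rightarrow> real" and s
    using frechet_derivative_cong_open[OF S that(1), of \<Theta> "\<lambda>_. 0"] that(2)
    by (simp add: frechet_derivative_const)
  \<comment> \<open>Of the three terms of the closedness relation, two are derivatives of mixed
    coefficients that vanish identically on the open set \<open>S\<close>.\<close>
  have flat: "frechet_derivative (\<Psi> (0, b1) (0, b2)) (at s) (a, 0) = 0" if "s \<in> S" for a s
    using pullback[OF that, of "(0, b1)" "(0, b2)" "(a, 0)"]
      zero[OF that, of "\<Psi> (0, b2) (a, 0)"] zero[OF that, of "\<Psi> (a, 0) (0, b1)"]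
    by (simp add: mixed mixed')
  define t where "t = snd d y"
  have k_pair: "snd k (x, y) = (snd c x, t)" for x by (simp add: k_def prod_chart_def t_def)
  have "(snd c x0, t) \<in> S"
    unfolding S_def k_pair[symmetric] using c d e by (intro imageI) (auto simp: D_def G_def k_def prod_chart_def)
  moreover have "open ((\<lambda>s. (s, t)) -` S)" by (intro open_vimage[OF S] continuous_intros)
  ultimately obtain \<epsilon> where \<epsilon>: "0 < \<epsilon>" "ball (snd c x0) \<epsilon> \<subseteq> (\<lambda>s. (s, t)) -` S"
    using openE[of "(\<lambda>s. (s, t)) -` S" "snd c x0"] by auto
  define \<phi> where "\<phi> s = \<Psi> (0, b1) (0, b2) (s, t)" for s
  have \<phi>': "(\<phi> has_derivative (\<lambda>_. 0)) (at s within ball (snd c x0) \<epsilon>)" if "s \<in> ball (snd c x0) \<epsilon>" for s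
  proof -
    have st: "(s, t) \<in> S" using \<epsilon>(2) that by auto
    have "(\<Psi> (0, b1) (0, b2) has_derivative frechet_derivative (\<Psi> (0, b1) (0, b2)) (at (s, t))) (at (s, t))"
      using pullback_differentiable[OF st] by (simp add: frechet_derivative_works)
    moreover have "((\<lambda>s. (s, t)) has_derivative (\<lambda>a. (a, 0))) (at s)"
      by (auto intro!: derivative_eq_intros)
    ultimately have "(\<phi> has_derivative (\<lambda>a. frechet_derivative (\<Psi> (0, b1) (0, b2)) (at (s, t)) (a, 0))) (at s)"
      unfolding \<phi>_def[abs_def] by (rule has_derivative_compose[rotated])
    then show ?thesis by (simp add: flat[OF st] has_derivative_at_withinI)
  qed
  have const: "\<phi> s = \<phi> (snd c x0)" if "s \<in> ball (snd c x0) \<epsilon>" for s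
    by (rule has_derivative_zero_unique[OF convex_ball \<phi>' that]) (simp_all add: \<epsilon>(1))
  define U where "U = fst c \<inter> snd c -` ball (snd c x0) \<epsilon>"
  have \<omega>_\<phi>: "\<omega> x = \<phi> (snd c x)" if "x \<in> U" for x
  proof -
    have "(snd c x, t) \<in> S" using that \<epsilon>(2) by (auto simp: U_def)
    then obtain x' y' where q: "(x', y') \<in> D" "(snd c x, t) = (snd c x', snd d y')"
      by (auto simp: S_def k_def prod_chart_def)
    \<comment> \<open>Membership of the coordinates in \<open>S\<close> yields only some preimage in
      \<open>D\<close>; injectivity of the two charts identifies it with
      \<open>(x, y)\<close>.\<close>
    have "x' = x" "y' = y"
      using q(2) c'(3)[OF D_dom(1)[OF q(1)]] d'(3)[OF D_dom(2)[OF q(1)]] c'(3)[of x] d'(3)[OF d(2)] that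
      by (auto simp: U_def t_def)
    then have "(x, y) \<in> D" using q by simp
    then show ?thesis
      unfolding \<phi>_def k_pair[symmetric] \<Psi>_push[OF \<open>(x, y) \<in> D\<close>] fibre[OF \<open>(x, y) \<in> D\<close>] \<omega>_def b1 b2
      by (simp add: G_def)
  qed
  have "open U" unfolding U_def by (rule continuous_open_preimage[OF c'(6,1) open_ball])
  moreover have "x0 \<in> U" using c \<epsilon> by (simp add: U_def)
  moreover have "\<omega> x = \<omega> x0" if "x \<in> U" for x
    using \<omega>_\<phi>[OF that] \<omega>_\<phi>[OF \<open>x0 \<in> U\<close>] const[of "snd c x"] that by (simp add: U_def)
  ultimately show ?thesis by (intro exI[of _ U] conjI ballI)
qed

text \<open>Connectedness of the base makes the fibre form globally constant. Evaluating it on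
  \<open>v\<close> and on the rotation of \<open>v\<close> at one base point bounds the warping
  function there by its value at any other.\<close>

lemma holomorphic_fibre_warping_constant:
  assumes conn: "connected (UNIV :: 'a set)"
  shows "f constant_on UNIV"
proof -
  have f: "0 < f x" for x
    using biwarped by (simp add: biwarped_product_submanifold_def biwarped_data_def)
  \<comment> \<open>Types are inhabited, so arbitrary points of the fibres can be used for a
    conclusion that mentions none.\<close>
  fix y :: 'b and z :: 'c
  obtain d where d: "d \<in> A1" "y \<in> fst d" using atlas_chart_at[OF atlases(3)] .
  \<comment> \<open>The model space has positive dimension, so the fibre has a nonzero tangent
    vector.\<close>
  obtain b :: 'eb where b: "b \<in> Basis" by (rule that[OF SOME_Basis])
  define v where "v = coord_vec A1 d y b"
  have v: "v \<in> tangent_space A1 y" unfolding v_def by (rule coord_vec_tangent[OF d])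
  have n: "0 < g1 y v v"
    using riemannian_metricD(3)[OF metrics(2) v] coord_vec_nonzero[OF atlases(3) d nonzero_Basis[OF b]]
    by (simp add: v_def)
  have form_const: "g (F (x, y, z)) (dF1 x y z w) (J (F (x, y, z)) (dF1 x y z v)) =
      g (F (x', y, z)) (dF1 x' y z w) (J (F (x', y, z)) (dF1 x' y z v))"
    if w: "w \<in> tangent_space A1 y" for w x x'
  proof -
    define \<omega> where "\<omega> x = g (F (x, y, z)) (dF1 x y z w) (J (F (x, y, z)) (dF1 x y z v))" for x
    have "\<forall>\<^sub>F x' in at x. \<omega> x = \<omega> x'" for x
    proof -
      obtain U where U: "open U" "x \<in> U" "\<forall>x'\<in>U. \<omega> x' = \<omega> x"
        using fibre_form_locally_constant[OF w v, of x z] unfolding \<omega>_def by (elim exE conjE)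
      show ?thesis
        by (rule eventually_mono[OF eventually_at_in_open'[OF U(1,2)]]) (rule bspec[OF U(3), symmetric])
    qed
    then have "\<omega> x = \<omega> x'"
      using connected_local_const[OF conn, of x x' \<omega>] by simp
    then show ?thesis unfolding \<omega>_def .
  qed
  have le: "f x \<le> f x'" for x x'
  proof -
    obtain w where w: "w \<in> tangent_space A1 y" and Jw: "J (F (x, y, z)) (dF1 x y z v) = dF1 x y z w"
      using fibre_rotate[OF v] .
    obtain w' where w': "w' \<in> tangent_space A1 y" and Jw': "J (F (x', y, z)) (dF1 x' y z v) = dF1 x' y z w'"
      using fibre_rotate[OF v] .
    \<comment> \<open>The same pair \<open>w\<close>, \<open>v\<close> is inserted at both base
      points. At \<open>x\<close> the vector \<open>w\<close> meets its own rotated partner, at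
      \<open>x'\<close> it meets the differently rotated \<open>w'\<close>.\<close>
    have "(f x)\<^sup>2 * g1 y w w = (f x')\<^sup>2 * g1 y w w'"
      using form_const[OF w, of x x'] by (simp add: Jw Jw' fibre_metric w w')
    moreover have norms: "g1 y w w = g1 y v v" "g1 y w' w' = g1 y v v"
      using fibre_rotate_norm[OF f v w Jw] fibre_rotate_norm[OF f v w' Jw'] .
    \<comment> \<open>Cauchy-Schwarz for two vectors of equal length, read off from the square of
      their difference being nonnegative.\<close>
    moreover have "g1 y w w' \<le> g1 y v v"
    proof -
      let ?r = "lincomb 1 w (-1) w'"
      have r: "?r \<in> tangent_space A1 y" by (rule lincomb_tangent[OF atlases(3) w w'])
      have "0 \<le> g1 y ?r ?r"
        using riemannian_metricD(3)[OF metrics(2) r] riemannian_metric_zero[OF atlases(3) metrics(2) zero_vec_tangent[OF atlases(3), of y]]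
        by (cases "?r = zero_vec") auto
      also have "g1 y ?r ?r = g1 y w w - 2 * g1 y w w' + g1 y w' w'"
        using riemannian_metricD(1)[OF metrics(2) w' w]
        by (simp add: riemannian_metricD(2)[OF metrics(2) w w' r]
            riemannian_metric_lincomb_right[OF atlases(3) metrics(2) w w' w]
            riemannian_metric_lincomb_right[OF atlases(3) metrics(2) w w' w'])
      finally show ?thesis using norms by simp
    qed
    ultimately have "(f x)\<^sup>2 * g1 y v v \<le> (f x')\<^sup>2 * g1 y v v"
      by (simp add: mult_left_mono)
    then have "(f x)\<^sup>2 \<le> (f x')\<^sup>2" using n by simp
    then show ?thesis by (rule power2_le_imp_le[OF _ less_imp_le[OF f]])
  qed
  \<comment> \<open>The inequality holds for both orders of the two points;
    \<open>f undefined\<close> serves as the constant.\<close>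
  then show ?thesis unfolding constant_on_def by (intro exI[of _ "f undefined"] ballI antisym)
qed

end

theorem corollary4p2:
  fixes A :: "('m::{t2_space,second_countable_topology}, 'e::euclidean_space) chart set"
    and J :: "'m \<Rightarrow> 'm tvec \<Rightarrow> 'm tvec"
    and g :: "'m metric_field"
  assumes "kaehler_manifold A J g"
  shows "\<not> (\<exists>(A\<^sub>\<theta> :: ('a::{t2_space,second_countable_topology}, 'ea::euclidean_space) chart set) g\<^sub>\<theta>
             (A\<^sub>T :: ('b::{t2_space,second_countable_topology}, 'eb::euclidean_space) chart set) g\<^sub>T
             (A\<^sub>R :: ('c::{t2_space,second_countable_topology}, 'ec::euclidean_space) chart set) g\<^sub>R
             f \<sigma> F.
           biwarped_product_submanifold A g A\<^sub>\<theta> g\<^sub>\<theta> A\<^sub>T g\<^sub>T A\<^sub>R g\<^sub>R f \<sigma> F \<and>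
           connected (UNIV :: 'a set) \<and>
           \<not> f constant_on UNIV \<and>
           (\<forall>y z. proper_pointwise_slant A\<^sub>\<theta> A J g (\<lambda>x. F (x, y, z)) \<or>
                  proper_slant A\<^sub>\<theta> A J g (\<lambda>x. F (x, y, z))) \<and>
           (\<forall>x z. holomorphic_submanifold A\<^sub>T A J (\<lambda>y. F (x, y, z))) \<and>
           (\<forall>x y. totally_real_submanifold A\<^sub>R A J g (\<lambda>z. F (x, y, z))))"
proof (intro notI, elim exE conjE)
  fix A\<^sub>\<theta> :: "('a, 'ea) chart set" and g\<^sub>\<theta> and A\<^sub>T :: "('b, 'eb) chart set" and g\<^sub>T
    and A\<^sub>R :: "('c, 'ec) chart set" and g\<^sub>R f \<sigma> F
  assume biwarped: "biwarped_product_submanifold A g A\<^sub>\<theta> g\<^sub>\<theta> A\<^sub>T g\<^sub>T A\<^sub>R g\<^sub>R f \<sigma> F"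
    and conn: "connected (UNIV :: 'a set)" and f: "\<not> f constant_on UNIV"
    and holomorphic: "\<forall>x z. holomorphic_submanifold A\<^sub>T A J (\<lambda>y. F (x, y, z))"
  show False
    using f holomorphic_fibre_warping_constant[OF assms biwarped holomorphic[rule_format] conn] by simp
qed

end
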